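(* Let $n\ge 1$ be an integer and $0<s<1$. Let $f:\mathbb R\to\mathbb R$ and $g:[0,+\infty)\to\mathbb R$ satisfy: (F1) $f$ is strictly increasing and $\limsup_{x_1\to-\infty} f(x_1)|x_1|^{2s}\le 0$; (F2) $g$ is locally Lipschitz and nondecreasing in $(0,+\infty)$; moreover $g'(u)$ is continuous near $u=0$, $g(0)=0$, $g'(0)=0$, and $g(u)>0$ for $u\in(0,+\infty)$. Let $u\in C^2(\mathbb R^n)\cap\mathcal L_{2s}$ be a positive bounded classical solution of $$(-\Delta)^s u(x)-\Delta u(x)=f(x_1)\,g(u(x)),\qquad x=(x_1,\dots,x_n)\in\mathbb R^n,$$ and suppose that $u$ is uniformly continuous on $\mathbb R^n$. Then $u$ is strictly monotone increasing in the $x_1$ direction.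
   Context: The space $\mathcal L_{2s}$ consists of functions $u:\mathbb R^n\to\mathbb R$ with $\int_{\mathbb R^n}\frac{|u(x)|}{1+|x|^{n+2s}}\,dx<+\infty$. The fractional Laplacian is $$(-\Delta)^s u(x)=C_{n,s}\lim_{\varepsilon\to0}\int_{\mathbb R^n\setminus B_\varepsilon(x)}\frac{u(x)-u(y)}{|x-y|^{n+2s}}\,dy,\qquad C_{n,s}=\frac{4^s s\,\Gamma(\frac{n+2s}{2})}{\pi^{n/2}\Gamma(1-s)}.$$ A classical solution is a function $u\in C^2(\mathbb R^n)\cap\mathcal L_{2s}$ satisfying the equation pointwise in $\mathbb R^n$. "Positive" means $u>0$ everywhere. *)

theory Defs
  imports "HOL-Analysis.Analysis"
begin

text \<open>
  The dimension \<open>n\<close> is \<open>CARD('n)\<close> and the first coordinate is a fixed index \<open>k :: 'n\<close>.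
\<close>

definition L_space :: "real \<Rightarrow> (real ^ 'n \<Rightarrow> real) set" where
  "L_space s = {u \<in> borel_measurable lebesgue.
     integrable lebesgue (\<lambda>x. \<bar>u x\<bar> / (1 + norm x powr (real CARD('n) + 2 * s)))}"

definition C2 :: "(real ^ 'n \<Rightarrow> real) \<Rightarrow> bool" where
  "C2 u \<longleftrightarrow> (\<exists>(u' :: real ^ 'n \<Rightarrow> (real ^ 'n) \<Rightarrow>\<^sub>L real)
                 (u'' :: real ^ 'n \<Rightarrow> (real ^ 'n) \<Rightarrow>\<^sub>L ((real ^ 'n) \<Rightarrow>\<^sub>L real)).
     (\<forall>x. (u has_derivative blinfun_apply (u' x)) (at x)) \<and>
     (\<forall>x. (u' has_derivative blinfun_apply (u'' x)) (at x)) \<and>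
     continuous_on UNIV u'')"

definition laplacian :: "(real ^ 'n \<Rightarrow> real) \<Rightarrow> real ^ 'n \<Rightarrow> real" where
  "laplacian u x = (\<Sum>i\<in>UNIV. (deriv ^^ 2) (\<lambda>t. u (x + t *\<^sub>R axis i 1)) 0)"

definition frac_const :: "nat \<Rightarrow> real \<Rightarrow> real" where
  "frac_const n s = 4 powr s * s * Gamma ((real n + 2 * s) / 2) /
     (pi powr (real n / 2) * Gamma (1 - s))"

text \<open>
  \<open>has_frac_laplacian s u x L\<close>: the principal value defining \<open>(-\<Delta>)\<^sup>s u(x)\<close> exists and equals
  \<open>L\<close>. For \<open>u \<in> L_space s\<close> the truncated integrals converge absolutely, so the convention that
  the Bochner integral of a non-integrable function is 0 plays no role.
\<close>

definition has_frac_laplacian ::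
    "real \<Rightarrow> (real ^ 'n \<Rightarrow> real) \<Rightarrow> real ^ 'n \<Rightarrow> real \<Rightarrow> bool" where
  "has_frac_laplacian s u x L \<longleftrightarrow>
     ((\<lambda>\<epsilon>. frac_const CARD('n) s *
         (LINT y : (- ball x \<epsilon>) | lebesgue.
            (u x - u y) / norm (x - y) powr (real CARD('n) + 2 * s))) \<longlongrightarrow> L) (at_right 0)"

definition classical_solution ::
    "'n \<Rightarrow> real \<Rightarrow> (real \<Rightarrow> real) \<Rightarrow> (real \<Rightarrow> real) \<Rightarrow> (real ^ 'n \<Rightarrow> real) \<Rightarrow> bool" where
  "classical_solution k s f g u \<longleftrightarrow>
     C2 u \<and> u \<in> L_space s \<and>
     (\<forall>x. \<exists>L. has_frac_laplacian s u x L \<and> L - laplacian u x = f (x $ k) * g (u x))"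

definition F1 :: "real \<Rightarrow> (real \<Rightarrow> real) \<Rightarrow> bool" where
  "F1 s f \<longleftrightarrow> strict_mono f \<and> Limsup at_bot (\<lambda>t. ereal (f t * \<bar>t\<bar> powr (2 * s))) \<le> 0"

text \<open>
  A function \<open>g : [0,\<infinity>) \<rightarrow> \<real>\<close> is represented by a total function of which only the values on
  \<open>{0..}\<close> matter; accordingly its derivative at 0 is one-sided.
\<close>

definition F2 :: "(real \<Rightarrow> real) \<Rightarrow> bool" where
  "F2 g \<longleftrightarrow>
     (\<forall>t>0. \<exists>r>0. \<exists>L. L-lipschitz_on (ball t r \<inter> {0<..}) g) \<and>
     mono_on {0<..} g \<and>
     (\<exists>\<delta>>0. \<exists>g'. (\<forall>t\<in>{0..<\<delta>}. (g has_real_derivative g' t) (at t within {0..})) \<and>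
        continuous_on {0..<\<delta>} g' \<and> g' 0 = 0) \<and>
     g 0 = 0 \<and>
     (\<forall>t>0. g t > 0)"

end

theory Submission imports Defs begin

text \<open>
  The proof moves planes. For a level \<open>l\<close> let \<open>R\<close> be the reflection in the hyperplane \<open>x\<^sub>k = l\<close>, let
  \<open>\<Sigma>\<close> be the half-space \<open>x\<^sub>k < l\<close>, and let \<open>w = u \<circ> R - u\<close>, which is antisymmetric under \<open>R\<close>. If
  \<open>w \<ge> 0\<close> on \<open>\<Sigma>\<close> for every \<open>l\<close>, then \<open>u\<close> is nondecreasing in \<open>x\<^sub>k\<close>, and it is strictly increasing
  because \<open>w\<close> cannot vanish at a point of \<open>\<Sigma>\<close>: there the left-hand side of the equation for \<open>w\<close>
  would be \<open>\<le> 0\<close>, while its right-hand side is \<open>(f (2 l - x\<^sub>k) - f x\<^sub>k) * g (u x) > 0\<close>.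

  Since \<open>u\<close> need not decay, the infimum \<open>-m\<close> of \<open>w\<close> on \<open>\<Sigma>\<close> is in general not attained. When it is
  negative, subtracting from \<open>w\<close> a small multiple of \<open>1 - |y - x0|\<^sup>2 / r\<^sup>2\<close>, with \<open>x0\<close> nearly
  minimal and \<open>r\<close> half the distance from \<open>x0\<close> to the hyperplane, moves the minimum to a nearby point
  \<open>x\<close> (\<open>near_minimum_point\<close>). This is where uniform continuity enters: it keeps \<open>x0\<close> away from the
  hyperplane, on which \<open>w = 0\<close>, so that the local term \<open>\<Delta>w(x)\<close> too is controlled by the small
  multiple. At \<open>x\<close> the nonlocal term wins by a definite amount: when each point is paired with its
  mirror image, antisymmetry leaves \<open>2 w(x)\<close> times the kernel of the opposite half-space
  (\<open>antisymmetric_almost_min_bound\<close>). With \<open>d = l - x\<^sub>k\<close> the result (\<open>violation_inequality\<close>) is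
  \<open>c * m * d powr (- 2 * s) \<le> f x\<^sub>k * g (u x) - f (2 l - x\<^sub>k) * g (u (R x))\<close>, where \<open>c > 0\<close> does not
  depend on \<open>l\<close>.

  This single inequality drives the continuation in \<open>l\<close>. As \<open>f\<close> increases and \<open>g\<close> has slope at most
  \<open>K\<close> on the range of \<open>u\<close>, it forces \<open>f x\<^sub>k > 0\<close> and \<open>c \<le> f x\<^sub>k * K * d powr (2 * s)\<close>. For \<open>l\<close> very negative this
  contradicts the decay of \<open>f\<close>, as \<open>d \<le> |x\<^sub>k|\<close>. If \<open>w \<ge> 0\<close> holds for \<open>l0\<close> and \<open>l > l0\<close> is close to \<open>l0\<close>, it
  bounds \<open>d\<close> from below (\<open>f\<close> is bounded above on the left) and from above (decay of \<open>f\<close>), and, because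
  the slope of \<open>g\<close> near 0 is small, it bounds \<open>u x\<close> from below. So the jump
  \<open>(f (2 l - x\<^sub>k) - f x\<^sub>k) * g (u (R x))\<close> stays away from 0, while \<open>g (u x) - g (u (R x))\<close> tends to 0 with
  \<open>l - l0\<close> by uniform continuity; the inequality fails. Hence the set of good levels
  contains a left half-line, is closed under limits from the left and open to the right; so it contains
  every level (\<open>continuation_along_line\<close>).
\<close>

section \<open>Integrals of the kernel \<open>|z| powr (- n - 2 s)\<close>\<close>

text \<open>
  A function that is at most \<open>b j\<close> on the \<open>j\<close>-th dyadic shell is dominated by the sum over \<open>j\<close> of
  \<open>b j\<close> times the indicator of the ball of radius \<open>R j\<close>, and a geometric bound on the integrals of
  these summands makes the sum converge. This replaces integration in polar coordinates, both for
  the singularity at 0 and for the tail at infinity.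
\<close>

lemma dyadic_domination:
  fixes h :: "'a::euclidean_space \<Rightarrow> real" and R b :: "nat \<Rightarrow> real"
  assumes [measurable]: "h \<in> borel_measurable borel" and nonneg: "\<And>z. 0 \<le> h z"
    and R: "\<And>j. 0 \<le> R j" and b: "\<And>j. 0 \<le> b j"
    and cover: "\<And>z. h z \<noteq> 0 \<Longrightarrow> \<exists>j. norm z < R j \<and> h z \<le> b j"
    and geom: "\<And>j. b j * R j ^ DIM('a) \<le> B * q ^ j" and q: "0 \<le> q" "q < 1"
  shows "integrable lborel h" "integral\<^sup>L lborel h \<le> unit_ball_vol DIM('a) * B / (1 - q)"
proof -
  let ?\<omega> = "unit_ball_vol (real DIM('a))"
  have \<omega>: "0 \<le> ?\<omega>" by simp
  have B: "0 \<le> B"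
    using geom[of 0] mult_nonneg_nonneg[OF b[of 0] zero_le_power[OF R[of 0], of "DIM('a)"]] by simp
  have "(\<integral>\<^sup>+z. ennreal (h z) \<partial>lborel)
      \<le> (\<integral>\<^sup>+z. (\<Sum>j. ennreal (b j) * indicator (ball 0 (R j)) (z :: 'a)) \<partial>lborel)"
  proof (intro nn_integral_mono)
    fix z :: 'a
    show "ennreal (h z) \<le> (\<Sum>j. ennreal (b j) * indicator (ball 0 (R j)) z)"
    proof (cases "h z = 0")
      case False
      then obtain j where j: "norm z < R j" "h z \<le> b j" using cover by blast
      have "ennreal (h z) \<le> (\<Sum>i\<in>{j}. ennreal (b i) * indicator (ball 0 (R i)) z)"
        using j by (simp add: ennreal_leI)
      also have "\<dots> \<le> (\<Sum>j. ennreal (b j) * indicator (ball 0 (R j)) z)"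
        by (intro sum_le_suminf) auto
      finally show ?thesis .
    qed simp
  qed
  also have "\<dots> = (\<Sum>j. \<integral>\<^sup>+z. ennreal (b j) * indicator (ball 0 (R j)) (z :: 'a) \<partial>lborel)"
    by (subst nn_integral_suminf) (auto intro!: borel_measurable_times_ennreal borel_measurable_indicator)
  also have "\<dots> = (\<Sum>j. ennreal (b j * (?\<omega> * R j ^ DIM('a))))"
    using R b by (intro suminf_cong) (simp add: nn_integral_cmult_indicator emeasure_ball ennreal_mult')
  also have "\<dots> \<le> (\<Sum>j. ennreal (?\<omega> * B * q ^ j))"
  proof (intro suminf_le ennreal_leI)
    fix j
    have "b j * (?\<omega> * R j ^ DIM('a)) = ?\<omega> * (b j * R j ^ DIM('a))" by simp
    also have "\<dots> \<le> ?\<omega> * (B * q ^ j)" by (intro mult_left_mono geom \<omega>)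
    finally show "b j * (?\<omega> * R j ^ DIM('a)) \<le> ?\<omega> * B * q ^ j" by simp
  qed auto
  also have "\<dots> = ennreal (?\<omega> * B / (1 - q))"
  proof (subst suminf_ennreal2)
    have "(\<lambda>j. ?\<omega> * B * q ^ j) sums (?\<omega> * B * (1 / (1 - q)))"
      using q by (intro sums_mult geometric_sums) auto
    then show "summable (\<lambda>j. ?\<omega> * B * q ^ j)"
      and "ennreal (\<Sum>j. ?\<omega> * B * q ^ j) = ennreal (?\<omega> * B / (1 - q))"
      by (auto simp: sums_iff)
  qed (use B q \<omega> in auto)
  finally have bound: "(\<integral>\<^sup>+z. ennreal (h z) \<partial>lborel) \<le> ennreal (?\<omega> * B / (1 - q))" .
  then have fin: "(\<integral>\<^sup>+z. ennreal (h z) \<partial>lborel) < \<infinity>"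
    by (rule le_less_trans) simp
  then show int: "integrable lborel h"
    using nonneg by (intro integrableI_nonneg) auto
  have "ennreal (integral\<^sup>L lborel h) \<le> ennreal (?\<omega> * B / (1 - q))"
    using bound nn_integral_eq_integral[OF int] nonneg by simp
  then show "integral\<^sup>L lborel h \<le> ?\<omega> * B / (1 - q)"
    by (subst (asm) ennreal_le_iff) (use B q \<omega> in auto)
qed

definition kern :: "real \<Rightarrow> real ^ 'n \<Rightarrow> real" where
  "kern s z = 1 / norm z powr (real CARD('n) + 2 * s)"

lemma kern_measurable [measurable]:
  "f \<in> borel_measurable M \<Longrightarrow> (\<lambda>x. kern s (f x)) \<in> borel_measurable M"
  unfolding kern_def by measurable

lemma ball_indicator_measurable [measurable]:
  "(indicator (ball x r) :: 'a::real_normed_vector \<Rightarrow> 'b::{real_normed_algebra_1}) \<in> borel_measurable borel"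
  "(indicator (- ball x r) :: 'a::real_normed_vector \<Rightarrow> 'b) \<in> borel_measurable borel"
  by (auto intro!: borel_measurable_indicator)

lemma kern_nonneg [simp]: "0 \<le> kern s z"
  by (simp add: kern_def)

lemma kern_mono:
  fixes y z :: "real ^ 'n"
  assumes "0 < s" "0 < norm z" "norm z \<le> norm y"
  shows "kern s y \<le> kern s z"
  unfolding kern_def using assms
  by (intro divide_left_mono powr_mono2 mult_pos_pos) auto

lemma dyadic_scale_below:
  fixes t r :: real assumes "0 < t" "t < r"
  obtains j :: nat where "r / 2 ^ (j + 1) \<le> t" "t < r / 2 ^ j"
proof -
  obtain N where N: "r / t < 2 ^ N" using real_arch_pow[of 2 "r / t"] by auto
  define j where "j = (LEAST j. r / 2 ^ (j + 1) \<le> t)"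
  have "r / 2 ^ (N + 1) \<le> t"
  proof -
    have "r < t * 2 ^ N" using N assms by (simp add: field_simps)
    also have "\<dots> \<le> t * 2 ^ (N+1)" using assms by simp
    finally show ?thesis by (simp add: field_simps)
  qed
  then have j: "r / 2 ^ (j + 1) \<le> t" unfolding j_def by (rule LeastI)
  have "t < r / 2 ^ j"
  proof (cases j)
    case (Suc i)
    then have "\<not> r / 2 ^ (i + 1) \<le> t" using not_less_Least[of i "\<lambda>j. r / 2 ^ (j + 1) \<le> t"] j_def by auto
    with Suc show ?thesis by simp
  qed (use assms in simp)
  with j show ?thesis using that by blast
qed

lemma dyadic_scale_above:
  fixes t r :: real assumes "0 < r" "r \<le> t"
  obtains j :: nat where "r * 2 ^ j \<le> t" "t < r * 2 ^ (j + 1)"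
proof -
  obtain N where N: "t / r < 2 ^ N" using real_arch_pow[of 2 "t / r"] by auto
  define j where "j = (LEAST j. t < r * 2 ^ (j + 1))"
  have "t < r * 2 ^ (N + 1)"
  proof -
    have "t < r * 2 ^ N" using N assms by (simp add: field_simps)
    also have "\<dots> \<le> r * 2 ^ (N+1)" using assms by simp
    finally show ?thesis .
  qed
  then have j: "t < r * 2 ^ (j + 1)" unfolding j_def by (rule LeastI)
  have "r * 2 ^ j \<le> t"
  proof (cases j)
    case (Suc i)
    then have "\<not> t < r * 2 ^ (i + 1)" using not_less_Least[of i "\<lambda>j. t < r * 2 ^ (j + 1)"] j_def by auto
    with Suc show ?thesis by simp
  qed (use assms in simp)
  with j show ?thesis using that by blast
qed

text \<open>
  On the shell \<open>r / 2 ^ (j + 1) \<le> |z| < r / 2 ^ j\<close> the integral is of order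
  \<open>(r / 2 ^ j) powr (2 - 2 s)\<close>, a convergent geometric progression because \<open>s < 1\<close>. The scaling in
  \<open>r\<close> matters: \<open>r\<close> will be comparable to a distance to the hyperplane that is not bounded.
\<close>

lemma near_kern_integral:
  assumes s: "0 < s" "s < 1"
  obtains C where "0 < C" and
    "\<And>r. 0 < r \<Longrightarrow> integrable lborel (\<lambda>z :: real ^ 'n. indicator (ball 0 r) z * ((norm z)\<^sup>2 * kern s z))"
    "\<And>r. 0 < r \<Longrightarrow> (\<integral>z. indicator (ball 0 r) (z :: real ^ 'n) * ((norm z)\<^sup>2 * kern s z) \<partial>lborel)
        \<le> C * r powr (2 - 2 * s)"
proof -
  define p where "p = real CARD('n) + 2 * s"
  define q where "q = 2 powr (2 * s - 2)"
  define C where "C = unit_ball_vol (real CARD('n)) * 2 powr p / (1 - q)"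
  have p: "0 < p" using s by (simp add: p_def add_nonneg_pos)
  have q: "0 < q" "q < 1" using s by (auto simp: q_def powr_less_one)
  have C: "0 < C" using q by (simp add: C_def)
  have main: "integrable lborel (\<lambda>z :: real ^ 'n. indicator (ball 0 r) z * ((norm z)\<^sup>2 * kern s z))
    \<and> (\<integral>z. indicator (ball 0 r) (z :: real ^ 'n) * ((norm z)\<^sup>2 * kern s z) \<partial>lborel) \<le> C * r powr (2 - 2 * s)"
    if r: "0 < r" for r
  proof -
    let ?h = "\<lambda>z :: real ^ 'n. indicator (ball 0 r) z * ((norm z)\<^sup>2 * kern s z)"
    define b where "b j = (r / 2 ^ j)\<^sup>2 / (r / 2 ^ (j + 1)) powr p" for j :: nat
    have cover: "\<exists>j. norm z < r / 2 ^ j \<and> ?h z \<le> b j" if "?h z \<noteq> 0" for z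
    proof -
      from that have z: "norm z < r" "0 < norm z" by (auto simp: indicator_def split: if_splits)
      then obtain j :: nat where j: "r / 2 ^ (j + 1) \<le> norm z" "norm z < r / 2 ^ j"
        using dyadic_scale_below by blast
      have "(norm z)\<^sup>2 / norm z powr p \<le> (r / 2 ^ j)\<^sup>2 / (r / 2 ^ (j + 1)) powr p"
        using j r p z by (intro frac_le power_mono powr_mono2) auto
      then show ?thesis using j z by (intro exI[of _ j]) (auto simp: kern_def p_def b_def)
    qed
    have geom: "b j * (r / 2 ^ j) ^ DIM(real ^ 'n) \<le> (2 powr p * r powr (2 - 2 * s)) * q ^ j" for j
    proof -
      have R: "0 < r / 2 ^ j" using r by simp
      have e: "(r / 2 ^ (j + 1)) powr p = (r / 2 ^ j) powr p * 2 powr (-p)"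
        using r by (simp add: powr_divide powr_mult powr_minus field_simps)
      have "b j * (r / 2 ^ j) ^ DIM(real ^ 'n)
         = (r / 2 ^ j) powr 2 * (r / 2 ^ j) powr (real CARD('n)) / ((r / 2 ^ j) powr p * 2 powr (-p))"
        unfolding b_def e using R r by (simp add: powr_realpow)
      also have "\<dots> = 2 powr p * (r / 2 ^ j) powr (2 - 2 * s)"
        using R by (simp add: powr_minus p_def powr_diff powr_add field_simps del: powr_numeral)
      also have "\<dots> = 2 powr p * (r powr (2 - 2 * s) * (2 ^ j) powr (2 * s - 2))"
        using r by (simp add: powr_divide powr_diff field_simps)
      also have "(2 ^ j :: real) powr (2 * s - 2) = q ^ j"
        by (simp add: q_def powr_powr flip: powr_realpow) (simp add: mult.commute)
      finally show ?thesis by simp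
    qed
    have meas: "?h \<in> borel_measurable borel" by measurable
    note dom = dyadic_domination[of ?h "\<lambda>j. r / 2 ^ j" b "2 powr p * r powr (2 - 2 * s)" q]
    have "integrable lborel ?h"
      by (rule dom(1)) (use r q cover geom meas in \<open>auto simp: b_def\<close>)
    moreover have "integral\<^sup>L lborel ?h \<le> unit_ball_vol DIM(real ^ 'n) * (2 powr p * r powr (2 - 2 * s)) / (1 - q)"
      by (rule dom(2)) (use r q cover geom meas in \<open>auto simp: b_def\<close>)
    ultimately show ?thesis by (simp add: C_def field_simps)
  qed
  with C show ?thesis using that by blast
qed

text \<open>
  On the shell \<open>r * 2 ^ j \<le> |z| < r * 2 ^ (j + 1)\<close> the integral is of order
  \<open>(r * 2 ^ j) powr (- 2 s)\<close>, a convergent geometric progression because \<open>s > 0\<close>.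
\<close>

lemma tail_kern_integral:
  assumes s: "0 < s"
  obtains C where "0 < C" and
    "\<And>r. 0 < r \<Longrightarrow> integrable lborel (\<lambda>z :: real ^ 'n. indicator (- ball 0 r) z * kern s z)"
    "\<And>r. 0 < r \<Longrightarrow> (\<integral>z. indicator (- ball 0 r) (z :: real ^ 'n) * kern s z \<partial>lborel) \<le> C * r powr (- 2 * s)"
proof -
  define p where "p = real CARD('n) + 2 * s"
  define q where "q = 2 powr (- 2 * s)"
  define C where "C = unit_ball_vol (real CARD('n)) * 2 ^ CARD('n) / (1 - q)"
  have p: "0 < p" using s by (simp add: p_def add_nonneg_pos)
  have q: "0 < q" "q < 1" using s by (auto simp: q_def powr_less_one)
  have C: "0 < C" using q by (simp add: C_def)
  have main: "integrable lborel (\<lambda>z :: real ^ 'n. indicator (- ball 0 r) z * kern s z)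
    \<and> (\<integral>z. indicator (- ball 0 r) (z :: real ^ 'n) * kern s z \<partial>lborel) \<le> C * r powr (- 2 * s)"
    if r: "0 < r" for r
  proof -
    let ?h = "\<lambda>z :: real ^ 'n. indicator (- ball 0 r) z * kern s z"
    define b where "b j = 1 / (r * 2 ^ j) powr p" for j :: nat
    have cover: "\<exists>j. norm z < r * 2 ^ (j + 1) \<and> ?h z \<le> b j" if "?h z \<noteq> 0" for z
    proof -
      from that have z: "r \<le> norm z" by (auto simp: indicator_def split: if_splits)
      then obtain j :: nat where j: "r * 2 ^ j \<le> norm z" "norm z < r * 2 ^ (j + 1)"
        using dyadic_scale_above r by blast
      have "1 / norm z powr p \<le> 1 / (r * 2 ^ j) powr p"
        using j r p z by (intro frac_le power_mono powr_mono2) auto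
      then show ?thesis using j z by (intro exI[of _ j]) (auto simp: kern_def p_def b_def)
    qed
    have geom: "b j * (r * 2 ^ (j + 1)) ^ DIM(real ^ 'n) \<le> (2 ^ CARD('n) * r powr (- 2 * s)) * q ^ j" for j
    proof -
      have R: "0 < r * 2 ^ j" using r by simp
      have "b j * (r * 2 ^ (j + 1)) ^ DIM(real ^ 'n)
         = 2 ^ CARD('n) * ((r * 2 ^ j) powr (real CARD('n)) / (r * 2 ^ j) powr p)"
        unfolding b_def using R r by (simp add: powr_realpow power_mult_distrib)
      also have "\<dots> = 2 ^ CARD('n) * (r * 2 ^ j) powr (- 2 * s)"
        using R by (simp add: p_def flip: powr_diff)
      also have "\<dots> = 2 ^ CARD('n) * (r powr (- 2 * s) * (2 ^ j) powr (- 2 * s))"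
        using r by (simp add: powr_mult)
      also have "(2 ^ j :: real) powr (- 2 * s) = q ^ j"
        by (simp add: q_def powr_powr flip: powr_realpow) (simp add: mult.commute)
      finally show ?thesis by simp
    qed
    have meas: "?h \<in> borel_measurable borel" by measurable
    note dom = dyadic_domination[of ?h "\<lambda>j. r * 2 ^ (j + 1)" b "2 ^ CARD('n) * r powr (- 2 * s)" q]
    have "integrable lborel ?h"
      by (rule dom(1)) (use r q cover geom meas in \<open>auto simp: b_def\<close>)
    moreover have "integral\<^sup>L lborel ?h \<le> unit_ball_vol DIM(real ^ 'n) * (2 ^ CARD('n) * r powr (- 2 * s)) / (1 - q)"
      by (rule dom(2)) (use r q cover geom meas in \<open>auto simp: b_def\<close>)
    ultimately show ?thesis by (simp add: C_def field_simps)
  qed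
  with C show ?thesis using that by blast
qed

section \<open>Reflections and the kernel of a half-space\<close>

definition reflect :: "'n \<Rightarrow> real \<Rightarrow> real ^ 'n \<Rightarrow> real ^ 'n" where
  "reflect k l x = x + (2 * (l - x $ k)) *\<^sub>R axis k 1"

lemma reflect_measure_preserving: "distr lborel borel (reflect k l) = (lborel :: (real ^ 'n) measure)"
proof -
  define c :: "real ^ 'n \<Rightarrow> real" where "c j = (if j = axis k 1 then -1 else 1)" for j
  have c: "\<bar>c j\<bar> = 1" "c j \<noteq> 0" for j by (auto simp: c_def)
  define t :: "real ^ 'n" where "t = (2 * l) *\<^sub>R axis k 1"
  have *: "(\<lambda>x. t + (\<Sum>j\<in>Basis. (c j * (x \<bullet> j)) *\<^sub>R j)) = reflect k l"
  proof
    fix x :: "real ^ 'n"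
    have ax: "axis k 1 \<in> (Basis :: (real ^ 'n) set)" by simp
    have "(\<Sum>j\<in>Basis. (c j * (x \<bullet> j)) *\<^sub>R j) = (\<Sum>j\<in>Basis. (x \<bullet> j) *\<^sub>R j - (if j = axis k 1 then (2 * (x \<bullet> j)) *\<^sub>R j else 0))"
      by (intro sum.cong) (auto simp: c_def algebra_simps simp flip: scaleR_2)
    also have "\<dots> = x - (2 * (x $ k)) *\<^sub>R axis k 1"
      by (simp add: sum_subtractf euclidean_representation sum.delta ax inner_axis cong: if_cong)
    finally show "t + (\<Sum>j\<in>Basis. (c j * (x \<bullet> j)) *\<^sub>R j) = reflect k l x"
      by (simp add: t_def reflect_def algebra_simps)
  qed
  have "(lborel :: (real ^ 'n) measure) = density (distr lborel borel (reflect k l)) (\<lambda>_. 1)"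
    using lborel_affine_euclidean[of c t] c unfolding * by simp
  then show ?thesis by (simp add: density_1)
qed

lemma point_reflection_measure_preserving: "distr lborel borel (\<lambda>y. a - y) = (lborel :: 'a::euclidean_space measure)"
proof -
  have *: "(\<lambda>x. a + (\<Sum>j\<in>Basis. ((-1) * (x \<bullet> j)) *\<^sub>R j)) = (\<lambda>y. a - y)"
    by (simp add: sum_negf euclidean_representation)
  have "(lborel :: 'a measure) = density (distr lborel borel (\<lambda>y. a - y)) (\<lambda>_. 1)"
    using lborel_affine_euclidean[of "\<lambda>_. -1" a] unfolding * by simp
  then show ?thesis by (simp add: density_1)
qed

lemma
  fixes T :: "'a::euclidean_space \<Rightarrow> 'a" and h :: "'a \<Rightarrow> real"
  assumes T: "distr lborel borel T = lborel" "T \<in> borel_measurable borel" and h: "h \<in> borel_measurable borel"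
  shows integrable_measure_preserving: "integrable lborel (\<lambda>y. h (T y)) \<longleftrightarrow> integrable lborel h"
    and integral_measure_preserving: "(\<integral>y. h (T y) \<partial>lborel) = integral\<^sup>L lborel h"
  using integrable_distr_eq[of T lborel borel h] integral_distr[of T lborel borel h] assms
  by simp_all


lemma point_reflection_integral:
  fixes h :: "'a::euclidean_space \<Rightarrow> real"
  assumes h: "h \<in> borel_measurable borel"
  shows "integrable lborel (\<lambda>y. h (a - y)) \<longleftrightarrow> integrable lborel h"
    and "(\<integral>y. h (a - y) \<partial>lborel) = integral\<^sup>L lborel h"
  using integrable_measure_preserving[OF point_reflection_measure_preserving _ h, of a]
    integral_measure_preserving[OF point_reflection_measure_preserving _ h, of a] by simp_all

lemma tail_kern_integrable:
  fixes x :: "real ^ 'n"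
  assumes "0 < s" "0 < r"
  shows "integrable lborel (\<lambda>y. indicator (- ball x r) y * kern s (x - y))"
proof -
  let ?h = "\<lambda>z :: real ^ 'n. indicator (- ball 0 r) z * kern s z"
  have meas: "?h \<in> borel_measurable borel" by measurable
  have "integrable lborel ?h"
    using tail_kern_integral[OF assms(1)] assms(2) by metis
  then have "integrable lborel (\<lambda>y. ?h (x - y))"
    by (subst point_reflection_integral(1)[OF meas])
  then show ?thesis by (simp add: indicator_def dist_norm norm_minus_commute)
qed

text \<open>
  The half-space beyond the hyperplane, at distance \<open>d\<close> from \<open>x\<close>, contains a ball of radius \<open>d\<close>
  all of whose points are within \<open>3 d\<close> of \<open>x\<close>. This lower bound is the source of the definite gain
  at a near minimum.
\<close>

lemma halfspace_kern_integral:
  fixes k :: "'n::finite" and x :: "real ^ 'n"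
  assumes s: "0 < s"
  obtains c where "0 < c"
    "\<And>(x :: real ^ 'n) l. x $ k < l \<Longrightarrow>
       c * (l - x $ k) powr (- 2 * s) \<le> (\<integral>y. indicator {y. l < y $ k} y * kern s (x - y) \<partial>lborel)"
proof -
  define p where "p = real CARD('n) + 2 * s"
  have p: "0 < p" using s by (simp add: p_def add_nonneg_pos)
  define c where "c = unit_ball_vol (real CARD('n)) * 3 powr (- p)"
  have c: "0 < c" by (simp add: c_def)
  moreover have "c * (l - x $ k) powr (- 2 * s) \<le> (\<integral>y. indicator {y. l < y $ k} y * kern s (x - y) \<partial>lborel)"
    if x: "x $ k < l" for x :: "real ^ 'n" and l
  proof -
    define d where "d = l - x $ k"
    have d: "0 < d" using x by (simp add: d_def)
    have far: "\<not> norm (x - y) < d" if "l < y $ k" for y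
      using that component_le_norm_cart[of "x - y" k] by (auto simp: d_def)
    have int: "integrable lborel (\<lambda>y. indicator {y. l < y $ k} y * kern s (x - y))"
      by (rule Bochner_Integration.integrable_bound[OF tail_kern_integrable[OF s d, of x]])
        (use far in \<open>auto simp: indicator_def dist_norm norm_minus_commute\<close>)
    define z where "z = x + (2 * d) *\<^sub>R axis k 1"
    have near: "l < y $ k \<and> 0 < norm (x - y) \<and> norm (x - y) < 3 * d" if "y \<in> ball z d" for y
    proof -
      have zy: "norm (z - y) < d" using that by (simp add: dist_norm)
      have "\<bar>z $ k - y $ k\<bar> < d" using component_le_norm_cart[of "z - y" k] zy by simp
      then have l: "l < y $ k" by (simp add: z_def d_def abs_if split: if_splits)
      have "norm (x - y) \<le> norm (x - z) + norm (z - y)" by norm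
      also have "norm (x - z) = 2 * d" using d by (simp add: z_def norm_axis_1)
      finally have "norm (x - y) < 3 * d" using zy by simp
      moreover have "x \<noteq> y" using l x by auto
      ultimately show ?thesis using l by simp
    qed
    have "c * d powr (- 2 * s) = (3 * d) powr (- p) * (unit_ball_vol (real CARD('n)) * d ^ CARD('n))"
      using d by (simp add: c_def p_def powr_mult powr_add powr_realpow powr_minus powr_diff field_simps)
    also have "\<dots> = (\<integral>y. indicator (ball z d) y * (3 * d) powr (- p) \<partial>lborel)"
      using d by (simp add: content_ball)
    also have "\<dots> \<le> (\<integral>y. indicator {y. l < y $ k} y * kern s (x - y) \<partial>lborel)"
    proof (intro integral_mono int)
      fix y
      show "indicator (ball z d) y * (3 * d) powr (- p) \<le> indicator {y. l < y $ k} y * kern s (x - y)"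
      proof (cases "y \<in> ball z d")
        case True
        then have "(3 * d) powr (- p) \<le> kern s (x - y)"
          using near[OF True] p d unfolding kern_def p_def[symmetric]
          by (simp add: powr_minus divide_inverse[symmetric] inverse_eq_divide) (intro divide_left_mono powr_mono2, auto)
        then show ?thesis using True near[OF True] by simp
      qed (simp add: indicator_def)
    qed (use d in \<open>auto intro!: integrable_mult_left integrable_real_indicator simp: emeasure_ball\<close>)
    finally show ?thesis by (simp add: d_def)
  qed
  ultimately show ?thesis using that by blast
qed

lemma reflect_reflect [simp]: "reflect k l (reflect k l x) = x"
  by (simp add: reflect_def algebra_simps)

lemma reflect_component [simp]: "reflect k l x $ k = 2 * l - x $ k"
  by (simp add: reflect_def)

lemma reflect_on_hyperplane: "x $ k = l \<Longrightarrow> reflect k l x = x"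
  by (simp add: reflect_def)

lemma continuous_on_reflect [continuous_intros]:
  "continuous_on A f \<Longrightarrow> continuous_on A (\<lambda>x. reflect k l (f x))"
  unfolding reflect_def by (intro continuous_intros)

lemma reflect_measurable [measurable]: "reflect k l \<in> borel_measurable borel"
  by (intro borel_measurable_continuous_onI continuous_intros)

lemma norm_diff_reflect:
  "(norm (x - reflect k l y))\<^sup>2 = (norm (x - y))\<^sup>2 + 4 * (l - x $ k) * (l - y $ k)"
proof -
  have "x - reflect k l y = (x - y) - (2 * (l - y $ k)) *\<^sub>R axis k 1"
    by (simp add: reflect_def)
  then show ?thesis
    unfolding \<open>x - reflect k l y = _\<close> power2_norm_eq_inner
    by (simp add: inner_diff_left inner_diff_right inner_axis inner_axis' algebra_simps)
qed

text \<open>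
  Two points on the same side are closer than a point and the mirror image of the other one, so
  that \<open>kern s (x - y)\<close> dominates the kernel of the reflected point.
\<close>

lemma norm_le_norm_diff_reflect:
  assumes "x $ k \<le> l" "y $ k \<le> l"
  shows "norm (x - y) \<le> norm (x - reflect k l y)"
proof -
  have "0 \<le> (l - x $ k) * (l - y $ k)" using assms by simp
  then have "(norm (x - y))\<^sup>2 \<le> (norm (x - reflect k l y))\<^sup>2"
    unfolding norm_diff_reflect mult.assoc by linarith
  then show ?thesis by (rule power2_le_imp_le) simp
qed

lemma norm_reflect_diff: "norm (reflect k l x - y) = norm (x - reflect k l y)"
proof -
  have "(norm (y - reflect k l x))\<^sup>2 = (norm (x - reflect k l y))\<^sup>2"
    unfolding norm_diff_reflect by (simp add: norm_minus_commute[of y x] algebra_simps)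
  then have "norm (y - reflect k l x) = norm (x - reflect k l y)"
    by (rule power2_eq_imp_eq) auto
  then show ?thesis by (simp add: norm_minus_commute)
qed

lemma reflect_integral:
  fixes h :: "real ^ 'n \<Rightarrow> real"
  assumes h: "h \<in> borel_measurable borel"
  shows "integrable lborel (\<lambda>y. h (reflect k l y)) \<longleftrightarrow> integrable lborel h"
    and "(\<integral>y. h (reflect k l y) \<partial>lborel) = integral\<^sup>L lborel h"
  using integrable_measure_preserving[OF reflect_measure_preserving _ h, of k l]
    integral_measure_preserving[OF reflect_measure_preserving _ h, of k l] by simp_all

section \<open>The fractional Laplacian at an almost minimum\<close>

definition refl_diff :: "'n \<Rightarrow> real \<Rightarrow> (real ^ 'n \<Rightarrow> real) \<Rightarrow> real ^ 'n \<Rightarrow> real" where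
  "refl_diff k l u y = u (reflect k l y) - u y"

text \<open>
  The parabola in the last condition is
  \<open>\<theta> * (norm (y - x0))\<^sup>2 / r\<^sup>2 - \<theta> * (norm (x - x0))\<^sup>2 / r\<^sup>2\<close> expanded at \<open>x\<close>: the condition says that
  \<open>x\<close> minimizes \<open>w y + \<theta> * (norm (y - x0))\<^sup>2 / r\<^sup>2\<close> over the half-space. Its linear part, which need
  not be small near \<open>x\<close>, is odd about \<open>x\<close> and disappears from the principal value. The
  flat bound by \<open>\<theta>\<close> is for \<open>y\<close> far away, where the parabola is too large to integrate.
\<close>

definition almost_min ::
    "'n \<Rightarrow> real \<Rightarrow> (real ^ 'n \<Rightarrow> real) \<Rightarrow> real ^ 'n \<Rightarrow> real ^ 'n \<Rightarrow> real \<Rightarrow> real \<Rightarrow> bool" where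
  "almost_min k l w x x0 r \<theta> \<longleftrightarrow>
     0 < r \<and> r \<le> l - x $ k \<and> norm (x - x0) \<le> r \<and> 0 < \<theta> \<and> w x \<le> 0 \<and>
     (\<forall>y. y $ k < l \<longrightarrow> w x - w y \<le> \<theta> \<and>
        w x - w y \<le> \<theta> * ((norm (y - x))\<^sup>2 + 2 * ((y - x) \<bullet> (x - x0))) / r\<^sup>2)"

text \<open>
  The truncated integral of the principal value, without the normalizing constant. For continuous
  \<open>w\<close> the integrand is a Borel function, so \<open>lborel\<close> may stand for its completion \<open>lebesgue\<close>.
\<close>

definition trunc_frac :: "real \<Rightarrow> (real ^ 'n \<Rightarrow> real) \<Rightarrow> real ^ 'n \<Rightarrow> real \<Rightarrow> real" where
  "trunc_frac s w x \<epsilon> = (\<integral>y. indicator (- ball x \<epsilon>) y * ((w x - w y) * kern s (x - y)) \<partial>lborel)"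

lemma trunc_frac_integrable:
  fixes w :: "real ^ 'n \<Rightarrow> real"
  assumes s: "0 < s" and \<epsilon>: "0 < \<epsilon>" and [measurable]: "w \<in> borel_measurable borel"
    and W: "\<And>y. \<bar>w y\<bar> \<le> W"
  shows "integrable lborel (\<lambda>y. indicator (- ball x \<epsilon>) y * ((w x - w y) * kern s (x - y)))"
proof (rule Bochner_Integration.integrable_bound)
  show "integrable lborel (\<lambda>y. (2 * W) * (indicator (- ball x \<epsilon>) y * kern s (x - y)))"
    by (intro integrable_mult_right tail_kern_integrable s \<epsilon>)
  show "AE y in lborel. norm (indicator (- ball x \<epsilon>) y * ((w x - w y) * kern s (x - y)))
      \<le> norm ((2 * W) * (indicator (- ball x \<epsilon>) y * kern s (x - y)))"
  proof (intro AE_I2)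
    fix y
    have "\<bar>w x - w y\<bar> \<le> \<bar>2 * W\<bar>" using W[of x] W[of y] by linarith
    then show "norm (indicator (- ball x \<epsilon>) y * ((w x - w y) * kern s (x - y)))
      \<le> norm ((2 * W) * (indicator (- ball x \<epsilon>) y * kern s (x - y)))"
      by (auto simp: abs_mult indicator_def intro!: mult_right_mono)
  qed
qed measurable

text \<open>
  A change of variables in each truncated integral shows that the fractional Laplacian commutes with
  the reflection. So the principal value for \<open>u \<circ> R - u\<close> at \<open>x\<close> exists because those for \<open>u\<close> exist at
  \<open>x\<close> and at \<open>R x\<close>.
\<close>

lemma has_frac_laplacian_reflect_diff:
  fixes u :: "real ^ 'n \<Rightarrow> real"
  assumes s: "0 < s" and cont: "continuous_on UNIV u" and W: "\<And>y. \<bar>u y\<bar> \<le> W"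
    and L1: "has_frac_laplacian s u (reflect k l x) L1" and L2: "has_frac_laplacian s u x L2"
  shows "((\<lambda>\<epsilon>. frac_const CARD('n) s * trunc_frac s (refl_diff k l u) x \<epsilon>) \<longlongrightarrow> L1 - L2) (at_right 0)"
proof -
  have [measurable]: "u \<in> borel_measurable borel"
    by (intro borel_measurable_continuous_onI cont)
  have lint: "(LINT y : (- ball x \<epsilon>) | lebesgue.
            (u x - u y) / norm (x - y) powr (real CARD('n) + 2 * s)) = trunc_frac s u x \<epsilon>" for x \<epsilon>
    unfolding set_lebesgue_integral_def trunc_frac_def kern_def
    by (subst integral_completion) auto
  have refl: "trunc_frac s u (reflect k l x) \<epsilon> =
     (\<integral>y. indicator (- ball x \<epsilon>) y * ((u (reflect k l x) - u (reflect k l y)) * kern s (x - y)) \<partial>lborel)" for \<epsilon>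
  proof -
    have "trunc_frac s u (reflect k l x) \<epsilon> =
      (\<integral>y. indicator (- ball (reflect k l x) \<epsilon>) (reflect k l y)
         * ((u (reflect k l x) - u (reflect k l y)) * kern s (reflect k l x - reflect k l y)) \<partial>lborel)"
      unfolding trunc_frac_def by (subst reflect_integral(2)) auto
    also have "\<dots> = (\<integral>y. indicator (- ball x \<epsilon>) y * ((u (reflect k l x) - u (reflect k l y)) * kern s (x - y)) \<partial>lborel)"
      by (simp add: kern_def norm_reflect_diff dist_norm indicator_def)
    finally show ?thesis .
  qed
  have diff: "trunc_frac s (refl_diff k l u) x \<epsilon> = trunc_frac s u (reflect k l x) \<epsilon> - trunc_frac s u x \<epsilon>"
    if \<epsilon>: "0 < \<epsilon>" for \<epsilon>
  proof -
    have "integrable lborel (\<lambda>y. indicator (- ball x \<epsilon>) y * ((u (reflect k l x) - u (reflect k l y)) * kern s (x - y)))"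
      using trunc_frac_integrable[OF s \<epsilon>, of "\<lambda>y. u (reflect k l y)" W x] W by simp
    moreover have "integrable lborel (\<lambda>y. indicator (- ball x \<epsilon>) y * ((u x - u y) * kern s (x - y)))"
      using trunc_frac_integrable[OF s \<epsilon>, of u W x] W by simp
    ultimately show ?thesis unfolding refl
      by (simp add: trunc_frac_def refl_diff_def algebra_simps flip: Bochner_Integration.integral_diff)
  qed
  have "((\<lambda>\<epsilon>. frac_const CARD('n) s * trunc_frac s u (reflect k l x) \<epsilon> - frac_const CARD('n) s * trunc_frac s u x \<epsilon>)
      \<longlongrightarrow> L1 - L2) (at_right 0)"
    using L1 L2 unfolding has_frac_laplacian_def lint by (rule tendsto_diff)
  then show ?thesis
    by (rule Lim_transform_eventually)
      (auto simp: eventually_at_right_less diff right_diff_distrib intro!: eventually_mono[OF eventually_at_right_less])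
qed

lemma odd_kern_integral:
  fixes x v :: "real ^ 'n" and \<epsilon> r :: real
  assumes s: "0 < s" and \<epsilon>: "0 < \<epsilon>"
  defines "h \<equiv> (\<lambda>y. indicator (- ball x \<epsilon>) y * (indicator (ball x r) y * (((y - x) \<bullet> v) * kern s (x - y))))"
  shows "integrable lborel h" "integral\<^sup>L lborel h = 0"
proof -
  have [measurable]: "h \<in> borel_measurable borel" unfolding h_def by measurable
  show "integrable lborel h"
  proof (rule Bochner_Integration.integrable_bound)
    show "integrable lborel (\<lambda>y. (\<bar>r\<bar> * norm v) * (indicator (- ball x \<epsilon>) y * kern s (x - y)))"
      by (intro integrable_mult_right tail_kern_integrable s \<epsilon>)
    show "AE y in lborel. norm (h y) \<le> norm ((\<bar>r\<bar> * norm v) * (indicator (- ball x \<epsilon>) y * kern s (x - y)))"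
    proof (intro AE_I2)
      fix y
      have "\<bar>(y - x) \<bullet> v\<bar> \<le> \<bar>r\<bar> * norm v" if "y \<in> ball x r"
      proof -
        have "\<bar>(y - x) \<bullet> v\<bar> \<le> norm (y - x) * norm v" by (rule Cauchy_Schwarz_ineq2)
        also have "\<dots> \<le> \<bar>r\<bar> * norm v" using that norm_minus_commute[of y x] by (intro mult_right_mono) (auto simp: dist_norm)
        finally show ?thesis .
      qed
      then show "norm (h y) \<le> norm ((\<bar>r\<bar> * norm v) * (indicator (- ball x \<epsilon>) y * kern s (x - y)))"
        by (auto simp: h_def abs_mult indicator_def intro!: mult_right_mono)
    qed
  qed measurable
  have "h (2 *\<^sub>R x - y) = - h y" for y
  proof -
    have e: "2 *\<^sub>R x - y - x = - (y - x)" "x - (2 *\<^sub>R x - y) = - (x - y)" by (simp_all add: scaleR_2)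
    have "dist x (2 *\<^sub>R x - y) = dist x y" unfolding dist_norm e by (rule norm_minus_cancel)
    then show ?thesis
      unfolding h_def e kern_def norm_minus_cancel inner_minus_left by (simp add: indicator_def)
  qed
  then have "integral\<^sup>L lborel h = - integral\<^sup>L lborel h"
    using point_reflection_integral(2)[of h "2 *\<^sub>R x"] by simp
  then show "integral\<^sup>L lborel h = 0" by simp
qed

lemma near_kern_integral_at:
  fixes C \<epsilon> r :: real and x :: "real ^ 'n"
  assumes C: "integrable lborel (\<lambda>z :: real ^ 'n. indicator (ball 0 r) z * ((norm z)\<^sup>2 * kern s z))"
    "(\<integral>z. indicator (ball 0 r) (z :: real ^ 'n) * ((norm z)\<^sup>2 * kern s z) \<partial>lborel) \<le> C"
  defines "h \<equiv> (\<lambda>y. indicator (- ball x \<epsilon>) y * (indicator (ball x r) y * ((norm (y - x))\<^sup>2 * kern s (x - y))))"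
  shows "integrable lborel h" "integral\<^sup>L lborel h \<le> C"
proof -
  let ?h = "\<lambda>z :: real ^ 'n. indicator (ball 0 r) z * ((norm z)\<^sup>2 * kern s z)"
  have meas: "?h \<in> borel_measurable borel" by measurable
  have int: "integrable lborel (\<lambda>y. ?h (x - y))" "(\<integral>y. ?h (x - y) \<partial>lborel) \<le> C"
    using C by (simp_all only: point_reflection_integral[OF meas])
  have le: "0 \<le> h y" "h y \<le> ?h (x - y)" for y
    by (auto simp: h_def indicator_def dist_norm norm_minus_commute)
  show inth: "integrable lborel h"
  proof (rule Bochner_Integration.integrable_bound[OF int(1)])
    show "h \<in> borel_measurable lborel" unfolding h_def by measurable
    show "AE y in lborel. norm (h y) \<le> norm (?h (x - y))"
      using le by (intro AE_I2) (smt (verit) real_norm_def)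
  qed
  have "integral\<^sup>L lborel h \<le> (\<integral>y. ?h (x - y) \<partial>lborel)"
    by (intro integral_mono inth int le)
  with int(2) show "integral\<^sup>L lborel h \<le> C" by simp
qed

text \<open>
  Write \<open>a\<close> and \<open>b\<close> for the kernel at \<open>x - y\<close> and at \<open>x - R y\<close>, with \<open>y\<close> in the half-space, so
  \<open>0 \<le> b \<le> a\<close>. By antisymmetry the integrand at \<open>y\<close> and the one at \<open>R y\<close> add up to
  \<open>(w x - w y) * (a - b) + 2 * w x * b\<close>. The first summand is at most of order \<open>\<theta>\<close> since \<open>x\<close> is an
  almost minimum; the second one is negative and integrates to \<open>2 * w x\<close> times the kernel of the
  opposite half-space. The proof exhibits a majorant \<open>H\<close> that beats the integrand \<open>G\<close> only after
  both are summed over the pair \<open>y\<close>, \<open>R y\<close>; as the reflection preserves the measure, this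
  suffices.
\<close>

lemma antisymmetric_almost_min_bound:
  fixes x x0 :: "real ^ 'n" and w :: "real ^ 'n \<Rightarrow> real"
  assumes s: "0 < s" and am: "almost_min k l w x x0 r \<theta>"
    and w [measurable]: "w \<in> borel_measurable borel" and W: "\<And>y. \<bar>w y\<bar> \<le> W"
    and anti: "\<And>y. w (reflect k l y) = - w y"
    and \<epsilon>: "0 < \<epsilon>" "\<epsilon> < r" and close: "\<And>y. norm (x - y) < \<epsilon> \<Longrightarrow> w y \<le> w x + \<theta>"
    and near: "integrable lborel (\<lambda>z :: real ^ 'n. indicator (ball 0 r) z * ((norm z)\<^sup>2 * kern s z))"
      "(\<integral>z. indicator (ball 0 r) (z :: real ^ 'n) * ((norm z)\<^sup>2 * kern s z) \<partial>lborel) \<le> Cn"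
    and tail: "(\<integral>z. indicator (- ball 0 r) (z :: real ^ 'n) * kern s z \<partial>lborel) \<le> Ct"
  shows "trunc_frac s w x \<epsilon> \<le> \<theta> * (Cn / r\<^sup>2 + 3 * Ct)
     + 2 * w x * (\<integral>y. indicator {y. l < y $ k} y * kern s (x - y) \<partial>lborel)"
proof -
  from am have r: "0 < r" "r \<le> l - x $ k" and x0: "norm (x - x0) \<le> r" and wx: "w x \<le> \<theta>" and \<theta>: "0 \<le> \<theta>"
    and flat: "\<And>y. y $ k < l \<Longrightarrow> w x - w y \<le> \<theta>"
    and para: "\<And>y. y $ k < l \<Longrightarrow> w x - w y \<le> \<theta> * ((norm (y - x))\<^sup>2 + 2 * ((y - x) \<bullet> (x - x0))) / r\<^sup>2"
    unfolding almost_min_def by auto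
  let ?R = "reflect k l"
  define G where "G y = indicator (- ball x \<epsilon>) y * ((w x - w y) * kern s (x - y))" for y
  define Q where "Q y = indicator (- ball x \<epsilon>) y * (indicator (ball x r) y * ((norm (y - x))\<^sup>2 * kern s (x - y)))" for y
  define Od where "Od y = indicator (- ball x \<epsilon>) y * (indicator (ball x r) y * (((y - x) \<bullet> (x - x0)) * kern s (x - y)))" for y
  define T where "T y = indicator (- ball x r) y * kern s (x - y)" for y
  define P where "P y = indicator {y. l < y $ k} y * kern s (x - y)" for y
  \<comment> \<open>\<open>Q\<close> and \<open>Od\<close> are the even and the odd part of the parabola near \<open>x\<close>, \<open>T\<close> is the tail, and \<open>P\<close>
    is the opposite half-space; \<open>2 * \<theta>\<close> of the coefficient of \<open>P\<close> absorbs what the odd part loses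
    when it is weighted by \<open>a - b\<close> instead of \<open>a\<close>.\<close>
  define H where "H y = \<theta> / r\<^sup>2 * Q y + 2 * \<theta> / r\<^sup>2 * Od y + \<theta> * T y + 2 * (w x + \<theta>) * P y" for y
  have xl: "x $ k < l" using r by simp
  have T: "integrable lborel T" "integral\<^sup>L lborel T \<le> Ct"
  proof -
    show "integrable lborel T" unfolding T_def by (rule tail_kern_integrable[OF s r(1)])
    have "T y = (\<lambda>z. indicator (- ball 0 r) z * kern s z) (x - y)" for y
      by (simp add: T_def indicator_def dist_norm norm_minus_commute)
    then have "T = (\<lambda>y. (\<lambda>z. indicator (- ball 0 r) z * kern s z) (x - y))" by auto
    then show "integral\<^sup>L lborel T \<le> Ct"
      using tail point_reflection_integral(2)[of "\<lambda>z. indicator (- ball 0 r) z * kern s z" x] by simp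
  qed
  have far: "r < norm (x - y)" if "l \<le> y $ k" "r < l - x $ k \<or> l < y $ k" for y
    using that r component_le_norm_cart[of "x - y" k] by auto
  have PT: "P y \<le> T y" for y
    using far[of y] by (cases "l < y $ k") (auto simp: P_def T_def indicator_def dist_norm)
  have P: "integrable lborel P"
  proof (rule Bochner_Integration.integrable_bound[OF T(1)])
    show "P \<in> borel_measurable lborel" unfolding P_def by measurable
    show "AE y in lborel. norm (P y) \<le> norm (T y)"
    proof (intro AE_I2)
      fix y
      show "norm (P y) \<le> norm (T y)"
        using PT[of y] by (simp add: P_def T_def)
    qed
  qed
  have Q: "integrable lborel Q" "integral\<^sup>L lborel Q \<le> Cn"
    unfolding Q_def by (rule near_kern_integral_at[OF near])+
  have Od: "integrable lborel Od" "integral\<^sup>L lborel Od = 0"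
    unfolding Od_def by (rule odd_kern_integral[OF s \<epsilon>(1)])+
  have H: "integrable lborel H"
    unfolding H_def by (intro Bochner_Integration.integrable_add integrable_mult_right T P Q Od)
  have G: "integrable lborel G"
    unfolding G_def by (rule trunc_frac_integrable[OF s \<epsilon>(1) w W])
  have [measurable]: "G \<in> borel_measurable borel" "H \<in> borel_measurable borel"
    using G H by (auto dest: borel_measurable_integrable)
  have pair_left: "G y + G (?R y) \<le> H y + H (?R y)" if y: "y $ k < l" for y
  proof -
    define a where "a = kern s (x - y)"
    define b where "b = kern s (x - ?R y)"
    have b: "0 \<le> b" by (simp add: b_def)
    have Ry: "l < ?R y $ k" using y by simp
    have d: "r < norm (x - ?R y)" using far[of "?R y"] Ry by auto
    have GR: "G (?R y) = (w x + w y) * b"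
      using d \<epsilon> by (simp add: G_def anti b_def indicator_def dist_norm)
    have HR: "H (?R y) = (2 * w x + 3 * \<theta>) * b"
      using d \<epsilon> Ry unfolding H_def Q_def Od_def T_def P_def b_def[symmetric]
      by (simp add: indicator_def dist_norm algebra_simps)
    consider "norm (x - y) < \<epsilon>" | "\<epsilon> \<le> norm (x - y)" "norm (x - y) < r" | "r \<le> norm (x - y)" by linarith
    then show ?thesis
    proof cases
      case 1
      then have "G y = 0" "H y = 0" using \<epsilon> y
        unfolding G_def H_def Q_def Od_def T_def P_def by (auto simp: dist_norm indicator_def)
      \<comment> \<open>Inside the removed ball only the mirror point contributes; \<open>\<epsilon>\<close> is small enough for \<open>w y\<close>
        to be close to \<open>w x\<close>.\<close>
      moreover have "(w x + w y) * b \<le> (2 * w x + 3 * \<theta>) * b"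
        using close[OF 1] \<theta> b by (intro mult_right_mono) auto
      ultimately show ?thesis using GR HR by simp
    next
      case 2
      then have ab: "b \<le> a" unfolding a_def b_def using \<epsilon> y xl s
        by (intro kern_mono norm_le_norm_diff_reflect) auto
      define p where "p = \<theta> * ((norm (y - x))\<^sup>2 + 2 * ((y - x) \<bullet> (x - x0))) / r\<^sup>2"
      have "G y = (w x - w y) * a" using 2 by (simp add: G_def a_def indicator_def dist_norm)
      moreover have "H y = p * a" using 2 y unfolding H_def Q_def Od_def T_def P_def p_def a_def
        by (simp add: indicator_def dist_norm divide_simps) (simp add: algebra_simps)
      moreover have "(w x - w y) * (a - b) \<le> p * (a - b)"
        using para[OF y] ab by (intro mult_right_mono) (auto simp: p_def)
      moreover have "- p * b \<le> 2 * \<theta> * b"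
      proof -
        have "\<bar>(y - x) \<bullet> (x - x0)\<bar> \<le> norm (y - x) * norm (x - x0)" by (rule Cauchy_Schwarz_ineq2)
        also have "\<dots> \<le> r * r" using 2 x0 r by (intro mult_mono) (auto simp: norm_minus_commute)
        finally have "- (r * r) \<le> (y - x) \<bullet> (x - x0)" by simp
        then have "- 2 * r\<^sup>2 \<le> (norm (y - x))\<^sup>2 + 2 * ((y - x) \<bullet> (x - x0))"
          using zero_le_power2[of "norm (y - x)"] unfolding power2_eq_square[of r] by linarith
        then have "\<theta> * (- 2 * r\<^sup>2) / r\<^sup>2 \<le> p" unfolding p_def
          using \<theta> by (intro divide_right_mono mult_left_mono) auto
        then have "- p \<le> 2 * \<theta>" using r by simp
        then show ?thesis using b by (intro mult_right_mono) auto
      qed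
      moreover have "0 \<le> \<theta> * b" using b \<theta> by simp
      ultimately show ?thesis using GR HR by (simp add: algebra_simps)
    next
      case 3
      then have ab: "b \<le> a" unfolding a_def b_def using r y xl s
        by (intro kern_mono norm_le_norm_diff_reflect) auto
      have "G y = (w x - w y) * a" using 3 \<epsilon> by (simp add: G_def a_def indicator_def dist_norm)
      moreover have "H y = \<theta> * a" using 3 y unfolding H_def Q_def Od_def T_def P_def a_def
        by (simp add: indicator_def dist_norm)
      moreover have "(w x - w y) * (a - b) \<le> \<theta> * (a - b)"
        using flat[OF y] ab by (intro mult_right_mono) auto
      moreover have "0 \<le> \<theta> * b" using b \<theta> by simp
      ultimately show ?thesis using GR HR by (simp add: algebra_simps)
    qed
  qed
  have pair: "G y + G (?R y) \<le> H y + H (?R y)" for y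
  proof -
    consider "y $ k < l" | "y $ k = l" | "?R y $ k < l" by fastforce
    then show ?thesis
    proof cases
      case 2
      then have Ry: "?R y = y" by (rule reflect_on_hyperplane)
      have wy: "w y = 0" using anti[of y] Ry by simp
      have "r \<le> norm (x - y)" using 2 r component_le_norm_cart[of "x - y" k] by auto
      then have "G y = w x * kern s (x - y)" "H y = \<theta> * kern s (x - y)"
        using wy \<epsilon> 2 unfolding G_def H_def Q_def Od_def T_def P_def by (simp_all add: indicator_def dist_norm)
      moreover have "w x * kern s (x - y) \<le> \<theta> * kern s (x - y)"
        using wx by (intro mult_right_mono) auto
      ultimately show ?thesis unfolding Ry by simp
    next
      case 3
      then show ?thesis using pair_left[of "?R y"] by simp
    qed (rule pair_left)
  qed
  have GR: "integrable lborel (\<lambda>y. G (?R y))" "(\<integral>y. G (?R y) \<partial>lborel) = integral\<^sup>L lborel G"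
    and HR: "integrable lborel (\<lambda>y. H (?R y))" "(\<integral>y. H (?R y) \<partial>lborel) = integral\<^sup>L lborel H"
    using G H by (simp_all add: reflect_integral)
  have "(\<integral>y. G y + G (?R y) \<partial>lborel) \<le> (\<integral>y. H y + H (?R y) \<partial>lborel)"
    by (intro integral_mono Bochner_Integration.integrable_add G H GR HR pair)
  then have "integral\<^sup>L lborel G \<le> integral\<^sup>L lborel H"
    using G H GR HR by simp
  also have "integral\<^sup>L lborel H = \<theta> / r\<^sup>2 * integral\<^sup>L lborel Q + 2 * \<theta> / r\<^sup>2 * integral\<^sup>L lborel Od
       + \<theta> * integral\<^sup>L lborel T + 2 * (w x + \<theta>) * integral\<^sup>L lborel P"
    unfolding H_def using T P Q Od by simp
  also have "\<dots> \<le> \<theta> / r\<^sup>2 * Cn + 0 + \<theta> * Ct + 2 * (w x + \<theta>) * integral\<^sup>L lborel P"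
    using Q(2) Od(2) T(2) \<theta> by (intro add_right_mono add_mono mult_left_mono) auto
  also have "2 * (w x + \<theta>) * integral\<^sup>L lborel P \<le> 2 * w x * integral\<^sup>L lborel P + 2 * (\<theta> * Ct)"
  proof -
    have "integral\<^sup>L lborel P \<le> integral\<^sup>L lborel T"
      by (intro integral_mono P T PT)
    then have "\<theta> * integral\<^sup>L lborel P \<le> \<theta> * Ct"
      using T(2) \<theta> by (intro mult_left_mono) auto
    then show ?thesis by (simp add: algebra_simps)
  qed
  finally show ?thesis
    by (simp add: G_def[abs_def] trunc_frac_def P_def[abs_def] algebra_simps)
qed

lemma frac_const_pos:
  assumes "0 < s" "s < 1"
  shows "0 < frac_const n s"
  unfolding frac_const_def using assms by (simp add: Gamma_real_pos add_nonneg_pos)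

text \<open>
  The gain \<open>c * refl_diff k l u x * d powr (- 2 * s)\<close>, negative or zero, is measured at the distance
  \<open>d = l - x $ k\<close>, whereas the error is proportional to \<open>\<theta>\<close>, which can be chosen small.
\<close>

lemma frac_laplacian_almost_min_bound:
  fixes k :: "'n::finite" and u :: "real ^ 'n \<Rightarrow> real"
  assumes s: "0 < s" "s < 1" and cont: "continuous_on UNIV u" and W: "\<And>y. \<bar>u y\<bar> \<le> W"
  obtains C c where "0 < C" "0 < c" and
    "\<And>l x x0 r \<theta> L1 L2. has_frac_laplacian s u (reflect k l x) L1 \<Longrightarrow> has_frac_laplacian s u x L2 \<Longrightarrow>
       almost_min k l (refl_diff k l u) x x0 r \<theta> \<Longrightarrow>
       L1 - L2 \<le> C * \<theta> * r powr (- 2 * s) + c * refl_diff k l u x * (l - x $ k) powr (- 2 * s)"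
proof -
  let ?\<gamma> = "frac_const CARD('n) s"
  have \<gamma>: "0 < ?\<gamma>" by (rule frac_const_pos[OF s])
  obtain Cn where Cn: "0 < Cn"
    "\<And>r. 0 < r \<Longrightarrow> integrable lborel (\<lambda>z :: real ^ 'n. indicator (ball 0 r) z * ((norm z)\<^sup>2 * kern s z))"
    "\<And>r. 0 < r \<Longrightarrow> (\<integral>z. indicator (ball 0 r) (z :: real ^ 'n) * ((norm z)\<^sup>2 * kern s z) \<partial>lborel)
        \<le> Cn * r powr (2 - 2 * s)"
    by (rule near_kern_integral[OF s, where 'n = 'n]) blast
  obtain Ct where Ct: "0 < Ct"
    "\<And>r. 0 < r \<Longrightarrow> (\<integral>z. indicator (- ball 0 r) (z :: real ^ 'n) * kern s z \<partial>lborel) \<le> Ct * r powr (- 2 * s)"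
    by (rule tail_kern_integral[OF s(1), where 'n = 'n]) blast
  obtain ch where ch: "0 < ch"
    "\<And>(x :: real ^ 'n) l. x $ k < l \<Longrightarrow>
       ch * (l - x $ k) powr (- 2 * s) \<le> (\<integral>y. indicator {y. l < y $ k} y * kern s (x - y) \<partial>lborel)"
    by (rule halfspace_kern_integral[OF s(1), of k]) blast
  show ?thesis
  proof
    show "0 < ?\<gamma> * (Cn + 3 * Ct)" "0 < 2 * ?\<gamma> * ch" using \<gamma> Cn(1) Ct(1) ch(1) by auto
    fix l x x0 r \<theta> L1 L2
    let ?R = "reflect k l"
    assume L: "has_frac_laplacian s u (?R x) L1" "has_frac_laplacian s u x L2"
      and am: "almost_min k l (refl_diff k l u) x x0 r \<theta>"
    define w where "w = refl_diff k l u"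
    have am: "almost_min k l w x x0 r \<theta>" using am by (simp add: w_def)
    then have r: "0 < r" "r \<le> l - x $ k" and \<theta>: "0 < \<theta>" and wx: "w x \<le> 0"
      by (auto simp: almost_min_def)
    have wc: "continuous_on UNIV w" unfolding w_def refl_diff_def[abs_def]
      by (intro continuous_intros continuous_on_compose2[OF cont]) auto
    then have meas: "w \<in> borel_measurable borel"
      by (rule borel_measurable_continuous_onI)
    have wW: "\<bar>w y\<bar> \<le> 2 * W" for y using W[of y] W[of "?R y"] by (simp add: w_def refl_diff_def)
    have "isCont w x" using wc by (simp add: continuous_on_eq_continuous_at)
    then obtain \<rho> where \<rho>: "0 < \<rho>" "\<And>y. norm (x - y) < \<rho> \<Longrightarrow> w y \<le> w x + \<theta>"
      unfolding continuous_at_eps_delta using \<theta>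
      by (smt (verit, best) dist_norm dist_commute real_norm_def)
    have bound: "?\<gamma> * trunc_frac s w x \<epsilon> \<le> ?\<gamma> * (Cn + 3 * Ct) * \<theta> * r powr (- 2 * s)
         + 2 * ?\<gamma> * ch * w x * (l - x $ k) powr (- 2 * s)"
      if \<epsilon>: "0 < \<epsilon>" "\<epsilon> < min r \<rho>" for \<epsilon>
    proof -
      let ?\<kappa> = "\<integral>y. indicator {y. l < y $ k} y * kern s (x - y) \<partial>lborel"
      have "trunc_frac s w x \<epsilon> \<le> \<theta> * (Cn * r powr (2 - 2 * s) / r\<^sup>2 + 3 * (Ct * r powr (- 2 * s))) + 2 * w x * ?\<kappa>"
        by (rule antisymmetric_almost_min_bound[OF s(1) am meas wW _ _ _ _ Cn(2,3) Ct(2)])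
          (use \<rho> \<epsilon> r in \<open>auto simp: w_def refl_diff_def\<close>)
      also have "Cn * r powr (2 - 2 * s) / r\<^sup>2 = Cn * r powr (- 2 * s)"
        using r by (simp add: powr_diff powr_minus field_simps)
      also have "2 * w x * ?\<kappa> \<le> 2 * w x * (ch * (l - x $ k) powr (- 2 * s))"
        using ch(2)[of x l] r wx by (intro mult_left_mono_neg) auto
      finally have "?\<gamma> * trunc_frac s w x \<epsilon> \<le> ?\<gamma> * (\<theta> * (Cn * r powr (- 2 * s) + 3 * (Ct * r powr (- 2 * s)))
          + 2 * w x * (ch * (l - x $ k) powr (- 2 * s)))"
        using \<gamma> by (intro mult_left_mono) auto
      then show ?thesis by (simp add: algebra_simps)
    qed
    have ev: "\<forall>\<^sub>F \<epsilon> in at_right 0. ?\<gamma> * trunc_frac s w x \<epsilon> \<le> ?\<gamma> * (Cn + 3 * Ct) * \<theta> * r powr (- 2 * s)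
         + 2 * ?\<gamma> * ch * w x * (l - x $ k) powr (- 2 * s)"
      using eventually_at_right_real[of 0 "min r \<rho>"] r \<rho> bound by (auto elim!: eventually_mono)
    have "((\<lambda>\<epsilon>. ?\<gamma> * trunc_frac s w x \<epsilon>) \<longlongrightarrow> L1 - L2) (at_right 0)"
      unfolding w_def by (rule has_frac_laplacian_reflect_diff[OF s(1) cont W L])
    from tendsto_upperbound[OF this ev]
    show "L1 - L2 \<le> ?\<gamma> * (Cn + 3 * Ct) * \<theta> * r powr (- 2 * s)
         + 2 * ?\<gamma> * ch * refl_diff k l u x * (l - x $ k) powr (- 2 * s)"
      by (simp add: w_def)
  qed
qed

section \<open>The Laplacian at an almost minimum\<close>

lemma second_derivative_nonneg_at_local_min:
  fixes \<phi> \<phi>' :: "real \<Rightarrow> real"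
  assumes d1: "\<And>t. (\<phi> has_real_derivative \<phi>' t) (at t)" and d2: "(\<phi>' has_real_derivative c) (at 0)"
    and r: "0 < r" and min: "\<And>t. \<bar>t\<bar> < r \<Longrightarrow> \<phi> 0 \<le> \<phi> t"
  shows "0 \<le> c"
proof (rule ccontr)
  assume "\<not> 0 \<le> c"
  have "\<phi>' 0 = 0"
    by (rule DERIV_local_min[OF d1 r]) (use min in auto)
  with DERIV_neg_dec_right[OF d2] \<open>\<not> 0 \<le> c\<close> obtain d where d: "0 < d" "\<And>h. 0 < h \<Longrightarrow> h < d \<Longrightarrow> \<phi>' h < 0"
    by force
  define h where "h = min d r / 2"
  have h: "0 < h" "h < d" "h < r" using d r by (auto simp: h_def min_def)
  obtain z where z: "0 < z" "z < h" "\<phi> h - \<phi> 0 = (h - 0) * \<phi>' z"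
    using MVT2[OF h(1)] d1 by blast
  have "\<phi>' z < 0" using z h d by simp
  then have "\<phi> h < \<phi> 0" using z(3) mult_pos_neg[OF h(1)] by fastforce
  then show False using min[of h] h by simp
qed

text \<open>
  \<open>H x e\<close> is the second derivative of \<open>u\<close> at \<open>x\<close> along \<open>e\<close>. It is even in \<open>e\<close>, so reversing the
  direction \<open>axis k 1\<close> by a reflection does not change it.
\<close>

lemma C2_slice_derivatives:
  fixes u :: "real ^ 'n \<Rightarrow> real"
  assumes "C2 u"
  obtains D H :: "real ^ 'n \<Rightarrow> real ^ 'n \<Rightarrow> real" where
    "\<And>x e t. ((\<lambda>t. u (x + t *\<^sub>R e)) has_real_derivative D (x + t *\<^sub>R e) e) (at t)"
    "\<And>x e t. ((\<lambda>t. D (x + t *\<^sub>R e) e) has_real_derivative H (x + t *\<^sub>R e) e) (at t)"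
    "\<And>x e. H x (- e) = H x e"
    "\<And>x. laplacian u x = (\<Sum>i\<in>UNIV. H x (axis i 1))"
proof -
  from assms obtain u' :: "real ^ 'n \<Rightarrow> (real ^ 'n) \<Rightarrow>\<^sub>L real"
    and u'' :: "real ^ 'n \<Rightarrow> (real ^ 'n) \<Rightarrow>\<^sub>L ((real ^ 'n) \<Rightarrow>\<^sub>L real)"
    where u': "\<And>x. (u has_derivative blinfun_apply (u' x)) (at x)"
      and u'': "\<And>x. (u' has_derivative blinfun_apply (u'' x)) (at x)"
    unfolding C2_def by blast
  define D where "D x e = u' x e" for x e
  define H where "H x e = u'' x e e" for x e
  have line: "((\<lambda>t. x + t *\<^sub>R e) has_derivative (\<lambda>t. t *\<^sub>R e)) (at t)" for x e :: "real ^ 'n" and t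
    by (auto intro!: derivative_eq_intros)
  have D: "((\<lambda>t. u (x + t *\<^sub>R e)) has_real_derivative D (x + t *\<^sub>R e) e) (at t)" for x e t
    using has_derivative_compose[OF line u', of x e t]
    by (simp add: has_field_derivative_def D_def blinfun.scaleR_right mult_commute_abs)
  have H: "((\<lambda>t. D (x + t *\<^sub>R e) e) has_real_derivative H (x + t *\<^sub>R e) e) (at t)" for x e t
  proof -
    have "((\<lambda>t. u' (x + t *\<^sub>R e)) has_derivative (\<lambda>h. u'' (x + t *\<^sub>R e) (h *\<^sub>R e))) (at t)"
      using has_derivative_compose[OF line u'', of x e t] by simp
    then have "((\<lambda>t. u' (x + t *\<^sub>R e) e) has_derivative (\<lambda>h. u'' (x + t *\<^sub>R e) (h *\<^sub>R e) e)) (at t)"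
      by (auto intro!: derivative_eq_intros)
    then show ?thesis
      by (simp add: has_field_derivative_def D_def H_def blinfun.scaleR_right blinfun.scaleR_left mult_commute_abs)
  qed
  have "laplacian u x = (\<Sum>i\<in>UNIV. H x (axis i 1))" for x
  proof -
    have "deriv (\<lambda>t. u (x + t *\<^sub>R axis i 1)) = (\<lambda>t. D (x + t *\<^sub>R axis i 1) (axis i 1))" for i
      by (rule ext) (rule DERIV_imp_deriv[OF D])
    moreover have "deriv (\<lambda>t. D (x + t *\<^sub>R axis i 1) (axis i 1)) 0 = H x (axis i 1)" for i
      using DERIV_imp_deriv[OF H[of x "axis i 1" 0]] by simp
    ultimately show ?thesis by (simp add: laplacian_def numeral_2_eq_2)
  qed
  moreover have "H x (- e) = H x e" for x e by (simp add: H_def blinfun.minus_right blinfun.minus_left)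
  ultimately show ?thesis by (intro that[of D H] D H)
qed

text \<open>
  Along each axis, the almost minimum is a genuine local minimum after a parabola with second derivative
  \<open>2 * \<theta> / r\<^sup>2\<close> has been added.
\<close>

lemma laplacian_almost_min_lower_bound:
  fixes x x0 :: "real ^ 'n" and u :: "real ^ 'n \<Rightarrow> real"
  assumes "C2 u" and am: "almost_min k l (refl_diff k l u) x x0 r \<theta>"
  shows "- (2 * real CARD('n) * \<theta> / r\<^sup>2) \<le> laplacian u (reflect k l x) - laplacian u x"
proof -
  from am have xl: "x $ k < l"
    and para: "\<And>y. y $ k < l \<Longrightarrow> (u (reflect k l x) - u x) - (u (reflect k l y) - u y)
        \<le> \<theta> * ((norm (y - x))\<^sup>2 + 2 * ((y - x) \<bullet> (x - x0))) / r\<^sup>2"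
    by (auto simp: almost_min_def refl_diff_def)
  obtain D H where D: "\<And>x e t. ((\<lambda>t. u (x + t *\<^sub>R e)) has_real_derivative D (x + t *\<^sub>R e) e) (at t)"
    and H: "\<And>x e t. ((\<lambda>t. D (x + t *\<^sub>R e) e) has_real_derivative H (x + t *\<^sub>R e) e) (at t)"
    and even: "\<And>x e. H x (- e) = H x e"
    and lap: "\<And>x. laplacian u x = (\<Sum>i\<in>UNIV. H x (axis i 1))"
    by (rule C2_slice_derivatives[OF assms(1)]) blast
  let ?R = "reflect k l"
  have "- (2 * \<theta> / r\<^sup>2) \<le> H (?R x) (axis i 1) - H x (axis i 1)" for i
  proof -
    let ?e = "axis i 1 :: real ^ 'n"
    define e' where "e' = (if i = k then - ?e else ?e)"
    have R: "?R (x + t *\<^sub>R ?e) = ?R x + t *\<^sub>R e'" for t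
      by (auto simp: reflect_def e'_def axis_def vec_eq_iff algebra_simps)
    define \<phi> where "\<phi> t = u (?R x + t *\<^sub>R e') - u (x + t *\<^sub>R ?e) + \<theta> * (t\<^sup>2 + 2 * t * (?e \<bullet> (x - x0))) / r\<^sup>2" for t
    define \<phi>' where "\<phi>' t = D (?R x + t *\<^sub>R e') e' - D (x + t *\<^sub>R ?e) ?e + \<theta> * (2 * t + 2 * (?e \<bullet> (x - x0))) / r\<^sup>2" for t
    have "(\<phi> has_real_derivative \<phi>' t) (at t)" for t
    proof -
      have "((\<lambda>t. \<theta> * (t\<^sup>2 + 2 * t * (?e \<bullet> (x - x0))) / r\<^sup>2) has_real_derivative
          \<theta> * (2 * t + 2 * (?e \<bullet> (x - x0))) / r\<^sup>2) (at t)"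
        by (intro DERIV_cdivide DERIV_cmult) (auto intro!: derivative_eq_intros)
      then show ?thesis unfolding \<phi>_def[abs_def] \<phi>'_def by (rule DERIV_add[OF DERIV_diff[OF D D]])
    qed
    moreover have "(\<phi>' has_real_derivative (H (?R x) e' - H x ?e + 2 * \<theta> / r\<^sup>2)) (at 0)"
    proof -
      have "((\<lambda>t. \<theta> * (2 * t + 2 * (?e \<bullet> (x - x0))) / r\<^sup>2) has_real_derivative \<theta> * 2 / r\<^sup>2) (at 0)"
        by (intro DERIV_cdivide DERIV_cmult) (auto intro!: derivative_eq_intros)
      note q = this
      have H0: "((\<lambda>t. D (y + t *\<^sub>R e) e) has_real_derivative H y e) (at 0)" for y e
        using H[of y e 0] by simp
      show ?thesis unfolding \<phi>'_def[abs_def]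
        using DERIV_add[OF DERIV_diff[OF H0 H0] q] by (simp only: mult.commute)
    qed
    moreover have "\<phi> 0 \<le> \<phi> t" if t: "\<bar>t\<bar> < l - x $ k" for t
    proof -
      have "(x + t *\<^sub>R ?e) $ k < l" using t xl by (auto simp: axis_def)
      from para[OF this] show ?thesis unfolding R
        by (simp add: \<phi>_def mult.assoc)
    qed
    ultimately have "0 \<le> H (?R x) e' - H x ?e + 2 * \<theta> / r\<^sup>2"
      using xl by (intro second_derivative_nonneg_at_local_min[of \<phi> \<phi>' _ "l - x $ k"]) auto
    moreover have "H (?R x) e' = H (?R x) ?e" using even by (simp add: e'_def)
    ultimately show ?thesis by simp
  qed
  then have "(\<Sum>i\<in>(UNIV :: 'n set). - (2 * \<theta> / r\<^sup>2)) \<le> (\<Sum>i\<in>UNIV. H (?R x) (axis i 1) - H x (axis i 1))"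
    by (intro sum_mono)
  then show ?thesis by (simp add: lap sum_subtractf mult_ac)
qed

section \<open>The equation at a point of violated order\<close>

text \<open>
  Here \<open>-m\<close> is the infimum of \<open>w\<close> over the half-space. Take \<open>x0\<close> with \<open>w x0 < - m + \<theta>\<close> and
  minimize \<open>w y - \<theta> * (1 - (norm (y - x0))\<^sup>2 / r\<^sup>2)\<close> over the closed ball of radius \<open>r\<close>. The value at
  \<open>x0\<close> is below \<open>-m\<close>, and outside the ball the perturbation only raises \<open>w \<ge> - m\<close>; so the
  minimum over the compact ball is a minimum over the whole half-space.

  The last bound says that both error terms of the equation, of order \<open>\<theta> * r powr (- 2 * s)\<close> and \<open>\<theta> / r\<^sup>2\<close>,
  are a small fraction of the gain of order \<open>m * r powr (- 2 * s)\<close>. For \<open>\<theta> / r\<^sup>2\<close> this needs a lower bound on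
  \<open>r\<close>, which comes from uniform continuity: \<open>w x0\<close> is at most \<open>- m / 2\<close>, but \<open>w\<close> is small near the
  hyperplane.
\<close>

lemma near_minimum_point:
  fixes u :: "real ^ 'n \<Rightarrow> real" and l s \<kappa> :: real
  assumes uc: "uniformly_continuous_on UNIV u" and bdd: "bounded (range u)"
    and s: "0 < s" "s < 1" and \<kappa>: "0 < \<kappa>"
    and neg: "\<exists>y. y $ k < l \<and> refl_diff k l u y < 0"
  obtains m \<theta> x x0 r where "0 < m" "almost_min k l (refl_diff k l u) x x0 r \<theta>" "l - x $ k \<le> 3 * r"
    "- m \<le> refl_diff k l u x" "refl_diff k l u x \<le> - (m / 2)"
    "\<theta> * (r powr (- 2 * s) + 1 / r\<^sup>2) \<le> \<kappa> * m * r powr (- 2 * s)"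
proof -
  let ?R = "reflect k l"
  define w where "w = refl_diff k l u"
  have w: "w y = u (?R y) - u y" for y by (simp add: w_def refl_diff_def)
  define S where "S = {y :: real ^ 'n. y $ k < l}"
  have cont: "continuous_on UNIV u" by (rule uniformly_continuous_imp_continuous[OF uc])
  have wc: "continuous_on UNIV w" unfolding w_def refl_diff_def[abs_def]
    by (intro continuous_intros continuous_on_compose2[OF cont]) auto
  obtain W where W: "\<And>y. \<bar>u y\<bar> \<le> W" using bdd by (auto simp: bounded_iff)
  have wW: "- (2 * W) \<le> w y" for y using W[of y] W[of "?R y"] by (simp add: w)
  define m where "m = - Inf (w ` S)"
  have bb: "bdd_below (w ` S)" using wW by (intro bdd_belowI2)
  have wm: "- m \<le> w y" if "y \<in> S" for y
    using cINF_lower[OF bb that] by (simp add: m_def)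
  have m: "0 < m" using neg wm unfolding S_def w_def by force
  obtain \<delta> where \<delta>: "0 < \<delta>" "\<And>y z. dist y z < \<delta> \<Longrightarrow> dist (u y) (u z) < m / 2"
    using uc m unfolding uniformly_continuous_on_def by (metis UNIV_I half_gt_zero)
  \<comment> \<open>The last entry is designed for \<open>\<eta> / r\<^sup>2 \<le> \<kappa> / 2 * r powr (- 2 * s)\<close>, given \<open>r \<ge> \<delta> / 4\<close>.\<close>
  define \<eta> where "\<eta> = min (1 / 2) (\<kappa> / 2 * min 1 ((\<delta> / 4) powr (2 - 2 * s)))"
  have \<eta>: "0 < \<eta>" "\<eta> \<le> 1 / 2" "\<eta> \<le> \<kappa> / 2" "\<eta> \<le> \<kappa> / 2 * (\<delta> / 4) powr (2 - 2 * s)"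
  proof -
    show "0 < \<eta>" "\<eta> \<le> 1 / 2" using \<kappa> \<delta> by (auto simp: \<eta>_def)
    have "\<eta> \<le> \<kappa> / 2 * min 1 ((\<delta> / 4) powr (2 - 2 * s))" by (simp add: \<eta>_def)
    moreover have "\<kappa> / 2 * min 1 ((\<delta> / 4) powr (2 - 2 * s)) \<le> \<kappa> / 2 * 1"
      "\<kappa> / 2 * min 1 ((\<delta> / 4) powr (2 - 2 * s)) \<le> \<kappa> / 2 * (\<delta> / 4) powr (2 - 2 * s)"
      using \<kappa> by (intro mult_left_mono; simp)+
    ultimately show "\<eta> \<le> \<kappa> / 2" "\<eta> \<le> \<kappa> / 2 * (\<delta> / 4) powr (2 - 2 * s)" by linarith+
  qed
  define \<theta> where "\<theta> = \<eta> * m"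
  have \<theta>: "0 < \<theta>" "\<theta> \<le> m / 2" using \<eta>(1,2) m mult_right_mono[OF \<eta>(2), of m] by (auto simp: \<theta>_def)
  have "S \<noteq> {}" using neg by (auto simp: S_def)
  then obtain x0 where x0: "x0 \<in> S" "w x0 < - m + \<theta>"
    using cInf_lessD[of "w ` S" "- m + \<theta>"] \<theta> by (auto simp: m_def)
  have x0l: "x0 $ k < l" using x0 by (simp add: S_def)
  define r where "r = (l - x0 $ k) / 2"
  have r: "0 < r" using x0l by (simp add: r_def)
  have "\<not> dist (?R x0) x0 < \<delta>"
  proof
    assume "dist (?R x0) x0 < \<delta>"
    then have "- (m / 2) < w x0" using \<delta>(2)[of "?R x0" x0] unfolding w dist_real_def by linarith
    then show False using x0 \<theta> by simp
  qed
  moreover have "dist (?R x0) x0 = 4 * r" using x0l by (simp add: reflect_def dist_norm norm_axis_1 r_def)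
  ultimately have r\<delta>: "\<delta> / 4 \<le> r" by simp
  define v where "v y = w y - \<theta> * (1 - (norm (y - x0))\<^sup>2 / r\<^sup>2)" for y
  have "continuous_on (cball x0 r) v" unfolding v_def
    by (intro continuous_intros continuous_on_subset[OF wc]) (use r in auto)
  then obtain x where x: "x \<in> cball x0 r" "\<And>y. y \<in> cball x0 r \<Longrightarrow> v x \<le> v y"
    using continuous_attains_inf[of "cball x0 r" v] r by (auto simp: less_imp_le)
  have xr: "norm (x - x0) \<le> r" using x(1) by (simp add: dist_norm norm_minus_commute)
  have xk: "\<bar>x $ k - x0 $ k\<bar> \<le> r" using component_le_norm_cart[of "x - x0" k] xr by simp
  then have xl: "r \<le> l - x $ k" "l - x $ k \<le> 3 * r" unfolding r_def by (auto simp: abs_if field_simps split: if_splits)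
  have xS: "x \<in> S" using xl r by (simp add: S_def)
  have vx: "v x < - m"
    using x(2)[of x0] x0(2) r by (simp add: v_def)
  have vmin: "v x \<le> v y" if y: "y \<in> S" for y
  proof (cases "y \<in> cball x0 r")
    case False
    then have "r\<^sup>2 \<le> (norm (y - x0))\<^sup>2" using r by (intro power_mono) (auto simp: dist_norm norm_minus_commute)
    then have "1 \<le> (norm (y - x0))\<^sup>2 / r\<^sup>2" using r by simp
    then have "\<theta> * (1 - (norm (y - x0))\<^sup>2 / r\<^sup>2) \<le> 0" using \<theta> by (simp add: mult_nonneg_nonpos)
    then show ?thesis using vx wm[OF y] by (simp add: v_def)
  qed (rule x(2))
  have wx: "w x \<le> - m + \<theta>"
  proof -
    have "\<theta> * (1 - (norm (x - x0))\<^sup>2 / r\<^sup>2) \<le> \<theta> * 1" using \<theta> by (intro mult_left_mono) auto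
    then show ?thesis using vx by (simp add: v_def)
  qed
  have para: "w x - w y \<le> \<theta> * ((norm (y - x))\<^sup>2 + 2 * ((y - x) \<bullet> (x - x0))) / r\<^sup>2" if "y \<in> S" for y
  proof -
    have "(norm (y - x0))\<^sup>2 = (norm (y - x))\<^sup>2 + 2 * ((y - x) \<bullet> (x - x0)) + (norm (x - x0))\<^sup>2"
      by (simp add: power2_norm_eq_inner inner_diff_left inner_diff_right inner_commute algebra_simps)
    then have "(norm (y - x))\<^sup>2 + 2 * ((y - x) \<bullet> (x - x0)) = (norm (y - x0))\<^sup>2 - (norm (x - x0))\<^sup>2"
      by simp
    then have "\<theta> * ((norm (y - x))\<^sup>2 + 2 * ((y - x) \<bullet> (x - x0))) / r\<^sup>2
       = \<theta> * ((norm (y - x0))\<^sup>2 / r\<^sup>2) - \<theta> * ((norm (x - x0))\<^sup>2 / r\<^sup>2)"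
      by (simp only: right_diff_distrib diff_divide_distrib times_divide_eq_right)
    then show ?thesis using vmin[OF that] by (simp add: v_def algebra_simps)
  qed
  have "\<theta> * (r powr (- 2 * s) + 1 / r\<^sup>2) \<le> \<kappa> * m * r powr (- 2 * s)"
  proof -
    have "\<theta> * r powr (- 2 * s) \<le> \<kappa> / 2 * m * r powr (- 2 * s)"
      unfolding \<theta>_def using \<eta>(3) m by (intro mult_right_mono) auto
    moreover have "\<theta> / r\<^sup>2 \<le> \<kappa> / 2 * m * r powr (- 2 * s)"
    proof -
      have "(\<delta> / 4) powr (2 - 2 * s) \<le> r powr (2 - 2 * s)" using \<delta> r\<delta> s by (intro powr_mono2) auto
      then have "\<eta> \<le> \<kappa> / 2 * r powr (2 - 2 * s)"
        using \<eta>(4) \<kappa> mult_left_mono[of "(\<delta> / 4) powr (2 - 2 * s)" "r powr (2 - 2 * s)" "\<kappa> / 2"] by linarith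
      also have "r powr (2 - 2 * s) = r\<^sup>2 * r powr (- 2 * s)"
        using r by (simp add: powr_diff powr_minus field_simps)
      finally have "\<eta> * m \<le> (\<kappa> / 2 * (r\<^sup>2 * r powr (- 2 * s))) * m" using m by (intro mult_right_mono) auto
      then show ?thesis using r by (simp add: \<theta>_def divide_le_eq mult_ac)
    qed
    moreover have "\<theta> * (r powr (- 2 * s) + 1 / r\<^sup>2) = \<theta> * r powr (- 2 * s) + \<theta> / r\<^sup>2"
      by (simp add: distrib_left)
    ultimately show ?thesis by linarith
  qed
  moreover have "w x - w y \<le> \<theta>" if "y \<in> S" for y using wm[OF that] wx by simp
  then have "almost_min k l w x x0 r \<theta>"
    using r xl xr \<theta> wx para unfolding almost_min_def S_def by auto
  ultimately show ?thesis
    using that[of m x x0 r \<theta>] m \<theta> xl wm[OF xS] wx unfolding w_def by simp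
qed

definition plane_ordered :: "'n \<Rightarrow> (real ^ 'n \<Rightarrow> real) \<Rightarrow> real \<Rightarrow> bool" where
  "plane_ordered k u l \<longleftrightarrow> (\<forall>y. y $ k < l \<longrightarrow> u y \<le> u (reflect k l y))"

text \<open>
  Subtracting the equation at \<open>x\<close> from the equation at its mirror image turns the bounds for the two
  operators into one for the right-hand sides.
\<close>

lemma solution_almost_min_bound:
  fixes k :: "'n::finite" and u :: "real ^ 'n \<Rightarrow> real"
  assumes s: "0 < s" "s < 1" and sol: "classical_solution k s f g u" and bdd: "bounded (range u)"
  obtains C c where "0 < C" "0 < c" and
    "\<And>l x x0 r \<theta>. almost_min k l (refl_diff k l u) x x0 r \<theta> \<Longrightarrow>
       f (2 * l - x $ k) * g (u (reflect k l x)) - f (x $ k) * g (u x)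
         \<le> C * (\<theta> * (r powr (- 2 * s) + 1 / r\<^sup>2)) + c * refl_diff k l u x * (l - x $ k) powr (- 2 * s)"
proof -
  have C2: "C2 u" using sol by (simp add: classical_solution_def)
  then have cont: "continuous_on UNIV u"
    unfolding C2_def by (meson continuous_at_imp_continuous_on has_derivative_continuous)
  obtain W where W: "\<And>y. \<bar>u y\<bar> \<le> W" using bdd by (auto simp: bounded_iff)
  obtain C c where C: "0 < C" and c: "0 < c" and main:
    "\<And>l x x0 r \<theta> L1 L2. has_frac_laplacian s u (reflect k l x) L1 \<Longrightarrow> has_frac_laplacian s u x L2 \<Longrightarrow>
       almost_min k l (refl_diff k l u) x x0 r \<theta> \<Longrightarrow>
       L1 - L2 \<le> C * \<theta> * r powr (- 2 * s) + c * refl_diff k l u x * (l - x $ k) powr (- 2 * s)"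
    by (rule frac_laplacian_almost_min_bound[OF s cont W, of k]) blast
  show ?thesis
  proof
    let ?C = "C + 2 * real CARD('n)"
    show "0 < ?C" "0 < c" using C c by auto
    fix l x x0 r \<theta>
    let ?R = "reflect k l"
    assume am: "almost_min k l (refl_diff k l u) x x0 r \<theta>"
    obtain L1 L2 where L: "has_frac_laplacian s u (?R x) L1" "has_frac_laplacian s u x L2"
      and eq: "L1 - laplacian u (?R x) = f (?R x $ k) * g (u (?R x))" "L2 - laplacian u x = f (x $ k) * g (u x)"
      using sol unfolding classical_solution_def by meson
    have "L1 - L2 \<le> C * \<theta> * r powr (- 2 * s) + c * refl_diff k l u x * (l - x $ k) powr (- 2 * s)"
      by (rule main[OF L am])
    moreover have "- (2 * real CARD('n) * \<theta> / r\<^sup>2) \<le> laplacian u (?R x) - laplacian u x"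
      by (rule laplacian_almost_min_lower_bound[OF C2 am])
    moreover have "C * \<theta> * r powr (- 2 * s) + 2 * real CARD('n) * \<theta> / r\<^sup>2 \<le> ?C * (\<theta> * (r powr (- 2 * s) + 1 / r\<^sup>2))"
    proof -
      have "0 < \<theta>" using am by (simp add: almost_min_def)
      then have "0 \<le> C * (\<theta> * (1 / r\<^sup>2)) + 2 * real CARD('n) * (\<theta> * r powr (- 2 * s))"
        using C by (intro add_nonneg_nonneg mult_nonneg_nonneg) auto
      then show ?thesis by (simp add: algebra_simps)
    qed
    ultimately show "f (2 * l - x $ k) * g (u (?R x)) - f (x $ k) * g (u x)
         \<le> ?C * (\<theta> * (r powr (- 2 * s) + 1 / r\<^sup>2)) + c * refl_diff k l u x * (l - x $ k) powr (- 2 * s)"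
      using eq unfolding reflect_component by linarith
  qed
qed

text \<open>
  Where the ordered functions \<open>u\<close> and \<open>u \<circ> R\<close> touch, \<open>x\<close> itself is an almost minimum for every
  \<open>\<theta> > 0\<close>, with vanishing gain; let \<open>\<theta>\<close> tend to 0.
\<close>

lemma touching_point_inequality:
  fixes k :: "'n::finite" and u :: "real ^ 'n \<Rightarrow> real"
  assumes s: "0 < s" "s < 1" and sol: "classical_solution k s f g u" and bdd: "bounded (range u)"
    and ordered: "plane_ordered k u l" and x: "x $ k < l" and touch: "u (reflect k l x) = u x"
  shows "f (2 * l - x $ k) * g (u x) \<le> f (x $ k) * g (u x)"
proof -
  obtain C c where C: "0 < C" and main:
    "\<And>l x x0 r \<theta>. almost_min k l (refl_diff k l u) x x0 r \<theta> \<Longrightarrow>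
       f (2 * l - x $ k) * g (u (reflect k l x)) - f (x $ k) * g (u x)
         \<le> C * (\<theta> * (r powr (- 2 * s) + 1 / r\<^sup>2)) + c * refl_diff k l u x * (l - x $ k) powr (- 2 * s)"
    by (rule solution_almost_min_bound[OF s sol bdd]) blast
  define r where "r = l - x $ k"
  have r: "0 < r" using x by (simp add: r_def)
  define D where "D = C * (r powr (- 2 * s) + 1 / r\<^sup>2)"
  have D: "0 < D" using C r by (simp add: D_def add_pos_pos)
  have bound: "f (2 * l - x $ k) * g (u x) - f (x $ k) * g (u x) \<le> D * \<theta>" if \<theta>: "0 < \<theta>" for \<theta>
  proof -
    have "refl_diff k l u x - refl_diff k l u y \<le> \<theta> \<and> refl_diff k l u x - refl_diff k l u y
        \<le> \<theta> * ((norm (y - x))\<^sup>2 + 2 * ((y - x) \<bullet> (x - x))) / r\<^sup>2" if "y $ k < l" for y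
    proof -
      have "refl_diff k l u x - refl_diff k l u y \<le> 0"
        using ordered that touch by (simp add: plane_ordered_def refl_diff_def)
      moreover have "0 \<le> \<theta> * ((norm (y - x))\<^sup>2 + 2 * ((y - x) \<bullet> (x - x))) / r\<^sup>2"
        using \<theta> by simp
      ultimately show ?thesis using \<theta> by linarith
    qed
    moreover have "refl_diff k l u x \<le> 0" by (simp add: refl_diff_def touch)
    ultimately have "almost_min k l (refl_diff k l u) x x r \<theta>"
      unfolding almost_min_def using \<theta> r by (auto simp only: r_def norm_zero diff_self)
    from main[OF this] show ?thesis by (simp add: touch refl_diff_def D_def mult_ac)
  qed
  have "f (2 * l - x $ k) * g (u x) - f (x $ k) * g (u x) \<le> 0 + e" if "0 < e" for e
    using bound[of "e / D"] D that by simp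
  from field_le_epsilon[OF this] show ?thesis by simp
qed

text \<open>
  The gain at a near minimum is at least twice the errors if \<open>\<kappa> = c / (36 * C)\<close>: half of \<open>m\<close> is lost because
  \<open>w x\<close> is only known to be at most \<open>- m / 2\<close>, and a factor 9 because \<open>d\<close> may be three times as
  large as \<open>r\<close>.
\<close>

lemma violation_inequality:
  fixes k :: "'n::finite" and u :: "real ^ 'n \<Rightarrow> real"
  assumes s: "0 < s" "s < 1" and sol: "classical_solution k s f g u" and bdd: "bounded (range u)"
    and uc: "uniformly_continuous_on UNIV u"
  obtains c where "0 < c"
    "\<And>l. \<not> plane_ordered k u l \<Longrightarrow> \<exists>x m. 0 < m \<and> x $ k < l \<and> u x - u (reflect k l x) \<le> m \<and>
       u (reflect k l x) < u x \<and> c * m * (l - x $ k) powr (- 2 * s)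
          \<le> f (x $ k) * g (u x) - f (2 * l - x $ k) * g (u (reflect k l x))"
proof -
  obtain C c where C: "0 < C" and c: "0 < c" and main:
    "\<And>l x x0 r \<theta>. almost_min k l (refl_diff k l u) x x0 r \<theta> \<Longrightarrow>
       f (2 * l - x $ k) * g (u (reflect k l x)) - f (x $ k) * g (u x)
         \<le> C * (\<theta> * (r powr (- 2 * s) + 1 / r\<^sup>2)) + c * refl_diff k l u x * (l - x $ k) powr (- 2 * s)"
    by (rule solution_almost_min_bound[OF s sol bdd]) blast
  show ?thesis
  proof (rule that[of "c / 4"])
    show "0 < c / 4" using c by simp
    fix l
    let ?R = "reflect k l"
    assume "\<not> plane_ordered k u l"
    then have neg: "\<exists>y. y $ k < l \<and> refl_diff k l u y < 0"
      by (auto simp: plane_ordered_def refl_diff_def not_le)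
    have \<kappa>: "0 < c / (36 * C)" using c C by simp
    obtain m \<theta> x x0 r where m: "0 < m" and am: "almost_min k l (refl_diff k l u) x x0 r \<theta>" and r: "l - x $ k \<le> 3 * r"
      and wx: "- m \<le> refl_diff k l u x" "refl_diff k l u x \<le> - (m / 2)"
      and small: "\<theta> * (r powr (- 2 * s) + 1 / r\<^sup>2) \<le> c / (36 * C) * m * r powr (- 2 * s)"
      by (rule near_minimum_point[OF uc bdd s \<kappa> neg]) blast
    define d where "d = l - x $ k"
    have d: "0 < d" "d \<le> 3 * r" "0 < r" using r am by (auto simp: d_def almost_min_def)
    have "f (2 * l - x $ k) * g (u (?R x)) - f (x $ k) * g (u x)
         \<le> C * (\<theta> * (r powr (- 2 * s) + 1 / r\<^sup>2)) + c * refl_diff k l u x * d powr (- 2 * s)"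
      unfolding d_def by (rule main[OF am])
    moreover have "C * (\<theta> * (r powr (- 2 * s) + 1 / r\<^sup>2)) \<le> c / 4 * m * d powr (- 2 * s)"
    proof -
      have "r powr (- 2 * s) \<le> 9 * d powr (- 2 * s)"
      proof -
        have "r powr (- 2 * s) \<le> (d / 3) powr (- 2 * s)"
          using d s by (intro powr_mono2') auto
        also have "\<dots> = 3 powr (2 * s) * d powr (- 2 * s)"
          using d by (simp add: powr_divide powr_minus field_simps)
        also have "\<dots> \<le> 3 powr 2 * d powr (- 2 * s)"
          using s by (intro mult_right_mono powr_mono) auto
        finally show ?thesis by simp
      qed
      then have "C * (c / (36 * C) * m * r powr (- 2 * s)) \<le> C * (c / (36 * C) * m * (9 * d powr (- 2 * s)))"
        using C c m by (intro mult_left_mono) auto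
      moreover have "C * (\<theta> * (r powr (- 2 * s) + 1 / r\<^sup>2)) \<le> C * (c / (36 * C) * m * r powr (- 2 * s))"
        using small C by (intro mult_left_mono) auto
      ultimately have "C * (\<theta> * (r powr (- 2 * s) + 1 / r\<^sup>2)) \<le> C * (c / (36 * C) * m * (9 * d powr (- 2 * s)))"
        by linarith
      also have "\<dots> = c / 4 * m * d powr (- 2 * s)" using C by simp
      finally show ?thesis .
    qed
    moreover have "c * refl_diff k l u x * d powr (- 2 * s) \<le> c * (- (m / 2)) * d powr (- 2 * s)"
      using wx c by (intro mult_right_mono mult_left_mono) auto
    moreover have "c * (- (m / 2)) * d powr (- 2 * s) = - (2 * (c / 4 * m * d powr (- 2 * s)))" by simp
    ultimately have "c / 4 * m * d powr (- 2 * s) \<le> f (x $ k) * g (u x) - f (2 * l - x $ k) * g (u (?R x))"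
      by linarith
    then show "\<exists>x m. 0 < m \<and> x $ k < l \<and> u x - u (?R x) \<le> m \<and> u (?R x) < u x \<and>
         c / 4 * m * (l - x $ k) powr (- 2 * s) \<le> f (x $ k) * g (u x) - f (2 * l - x $ k) * g (u (?R x))"
      using m wx d unfolding d_def refl_diff_def by (intro exI[of _ x] exI[of _ m]) auto
  qed
qed

section \<open>The nonlinearities\<close>

lemma small_slope_near_zero:
  assumes F2: "F2 g" and e: "0 < e"
  obtains \<delta> where "0 < \<delta>" "\<And>a b. 0 < a \<Longrightarrow> a \<le> b \<Longrightarrow> b < \<delta> \<Longrightarrow> g b - g a \<le> e * (b - a)"
proof -
  from F2 obtain \<delta>0 g' where \<delta>0: "0 < \<delta>0"
    and g': "\<And>t. t \<in> {0..<\<delta>0} \<Longrightarrow> (g has_real_derivative g' t) (at t within {0..})"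
    and c: "continuous_on {0..<\<delta>0} g'" and z: "g' 0 = 0"
    unfolding F2_def by blast
  from c have "\<exists>d>0. \<forall>t\<in>{0..<\<delta>0}. dist t 0 < d \<longrightarrow> dist (g' t) (g' 0) < e"
    using c[unfolded continuous_on_iff, rule_format, of 0 e] \<delta>0 e by simp
  then obtain d where d: "0 < d" "\<And>t. 0 \<le> t \<Longrightarrow> t < \<delta>0 \<Longrightarrow> t < d \<Longrightarrow> g' t < e"
    using z by (force simp: dist_norm)
  have "g b - g a \<le> e * (b - a)" if ab: "0 < a" "a \<le> b" "b < min d \<delta>0" for a b
  proof (cases "a = b")
    case False
    then have "a < b" using ab by simp
    moreover have "(g has_real_derivative g' t) (at t)" if "a \<le> t" "t \<le> b" for t
    proof -
      have "at t within {0..} = at t" using that ab by (intro at_within_interior) auto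
      then show ?thesis using g'[of t] that ab by simp
    qed
    ultimately obtain t where "a < t" "t < b" "g b - g a = (b - a) * g' t"
      using MVT2[of a b g g'] by blast
    then show ?thesis using d(2)[of t] ab by (simp add: mult.commute)
  qed simp
  then show ?thesis using that[of "min d \<delta>0"] d \<delta>0 by simp
qed


text \<open>
  Local slope bounds hold near every point of \<open>{0..M}\<close>: at 0 by the continuity of \<open>g'\<close>, elsewhere
  by hypothesis. They combine over adjacent intervals, so bisection yields one bound for all of
  \<open>{0..M}\<close>.
\<close>

lemma upper_lipschitz_down_to_zero:
  assumes F2: "F2 g"
  obtains K where "0 < K" "\<And>a b. 0 < a \<Longrightarrow> a \<le> b \<Longrightarrow> b \<le> M \<Longrightarrow> g b - g a \<le> K * (b - a)"
proof (cases "0 \<le> M")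
  case True
  define P where "P p q \<longleftrightarrow> (\<exists>K. \<forall>a b. p \<le> a \<and> 0 < a \<and> a \<le> b \<and> b \<le> q \<longrightarrow> g b - g a \<le> K * (b - a))" for p q
  have "P 0 M"
    using True
  proof (induction rule: Bolzano)
    case (trans p m q)
    then obtain K1 K2 where K1: "\<And>a b. p \<le> a \<Longrightarrow> 0 < a \<Longrightarrow> a \<le> b \<Longrightarrow> b \<le> m \<Longrightarrow> g b - g a \<le> K1 * (b - a)"
      and K2: "\<And>a b. m \<le> a \<Longrightarrow> 0 < a \<Longrightarrow> a \<le> b \<Longrightarrow> b \<le> q \<Longrightarrow> g b - g a \<le> K2 * (b - a)"
      unfolding P_def by blast
    have "g b - g a \<le> max K1 K2 * (b - a)" if ab: "p \<le> a" "0 < a" "a \<le> b" "b \<le> q" for a b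
    proof -
      have mono: "K1 * t \<le> max K1 K2 * t" "K2 * t \<le> max K1 K2 * t" if "0 \<le> t" for t
        using that by (auto intro: mult_right_mono)
      consider "b \<le> m" | "m \<le> a" | "a \<le> m" "m \<le> b" by linarith
      then show ?thesis
      proof cases
        case 1 then show ?thesis using K1[of a b] mono(1)[of "b - a"] ab by simp
      next
        case 2 then show ?thesis using K2[of a b] mono(2)[of "b - a"] ab by simp
      next
        case 3
        have "g b - g a = (g b - g m) + (g m - g a)" by simp
        also have "\<dots> \<le> max K1 K2 * (b - m) + max K1 K2 * (m - a)"
          using 3 ab K1[of a m] K2[of m b] mono(1)[of "m - a"] mono(2)[of "b - m"] by simp
        finally show ?thesis by (simp add: algebra_simps)
      qed
    qed
    then show ?case unfolding P_def by blast
  next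
    case (local t)
    show ?case
    proof (cases "t = 0")
      case True
      obtain \<delta> where \<delta>: "0 < \<delta>" "\<And>a b. 0 < a \<Longrightarrow> a \<le> b \<Longrightarrow> b < \<delta> \<Longrightarrow> g b - g a \<le> 1 * (b - a)"
        using small_slope_near_zero[OF F2, of 1] by auto
      show ?thesis
        unfolding P_def using \<delta> True
        by (intro exI[of _ \<delta>] conjI allI impI exI[of _ 1] \<delta>) auto
    next
      case False
      then have t: "0 < t" using local by simp
      with F2 obtain r L where r: "0 < r" and L: "L-lipschitz_on (ball t r \<inter> {0<..}) g"
        unfolding F2_def by blast
      have "g b - g a \<le> L * (b - a)"
        if "p \<le> t" "t \<le> q" "q - p < r" "p \<le> a" "0 < a" "a \<le> b" "b \<le> q" for p q a b
      proof -
        have "dist (g b) (g a) \<le> L * dist b a"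
          by (rule lipschitz_onD[OF L]) (use that in \<open>auto simp: dist_real_def\<close>)
        then show ?thesis using that by (simp add: dist_real_def)
      qed
      then show ?thesis unfolding P_def using r by blast
    qed
  qed
  then obtain K where K: "\<And>a b. 0 < a \<Longrightarrow> a \<le> b \<Longrightarrow> b \<le> M \<Longrightarrow> g b - g a \<le> K * (b - a)"
    unfolding P_def by (meson less_imp_le)
  have "g b - g a \<le> max K 1 * (b - a)" if "0 < a" "a \<le> b" "b \<le> M" for a b
  proof -
    have "K * (b - a) \<le> max K 1 * (b - a)" using that by (intro mult_right_mono) auto
    with K[OF that] show ?thesis by simp
  qed
  then show ?thesis using that[of "max K 1"] by simp
qed (use that[of 1] in simp)

text \<open>
  The consequence of the violation inequality that is used at every stage. Here \<open>ft\<close>, \<open>ft'\<close>,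
  \<open>ga\<close>, \<open>gb\<close> stand for the values of \<open>f\<close> and \<open>g\<close> at the point and at its mirror image. Dropping the
  increase from \<open>ft\<close> to \<open>ft'\<close> leaves \<open>c * m * d powr (- 2 * s) \<le> ft * (ga - gb)\<close>, and \<open>m\<close> cancels since
  \<open>ga - gb \<le> \<kappa> * m\<close>.
\<close>

lemma reaction_forces_slope:
  fixes c m d s ft ft' ga gb a b \<kappa> :: real
  assumes ineq: "c * m * d powr (- 2 * s) \<le> ft * ga - ft' * gb"
    and pos: "0 < c" "0 < m" "0 < d" and f: "ft < ft'" and g: "0 < gb" "gb \<le> ga"
    and slope: "ga - gb \<le> \<kappa> * (a - b)" and ab: "b < a" "a - b \<le> m"
  shows "0 < ft" "c \<le> ft * \<kappa> * d powr (2 * s)"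
proof -
  have "ft * gb \<le> ft' * gb" using f g by simp
  then have *: "c * m * d powr (- 2 * s) \<le> ft * (ga - gb)" using ineq by (simp add: algebra_simps)
  have "0 < c * m * d powr (- 2 * s)" using pos by simp
  then have "0 < ft * (ga - gb)" using * by linarith
  then show ft: "0 < ft" using g by (simp add: zero_less_mult_iff)
  have gab: "0 < ga - gb" using \<open>0 < ft * (ga - gb)\<close> ft by (simp add: zero_less_mult_iff)
  then have "0 < \<kappa> * (a - b)" using slope by linarith
  then have \<kappa>: "0 < \<kappa>" using ab by (simp add: zero_less_mult_iff)
  have "ga - gb \<le> \<kappa> * m" using slope mult_left_mono[OF ab(2), of \<kappa>] \<kappa> by linarith
  then have "ft * (ga - gb) \<le> ft * (\<kappa> * m)" using ft by (intro mult_left_mono) auto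
  with * have "(c * d powr (- 2 * s)) * m \<le> (ft * \<kappa>) * m" by (simp add: mult_ac)
  then have "c * d powr (- 2 * s) \<le> ft * \<kappa>" using pos by simp
  then have "c * d powr (- 2 * s) * d powr (2 * s) \<le> ft * \<kappa> * d powr (2 * s)"
    by (intro mult_right_mono) auto
  then show "c \<le> ft * \<kappa> * d powr (2 * s)"
    using pos by (simp add: mult.assoc flip: powr_add)
qed

lemma F1_decay:
  assumes "F1 s f" "0 < e"
  obtains N where "N < 0" "\<And>t. t \<le> N \<Longrightarrow> f t * \<bar>t\<bar> powr (2 * s) < e"
proof -
  have "Limsup at_bot (\<lambda>t. ereal (f t * \<bar>t\<bar> powr (2 * s))) < ereal e"
    using assms unfolding F1_def by (auto intro: le_less_trans)
  then have "eventually (\<lambda>t. ereal (f t * \<bar>t\<bar> powr (2 * s)) < ereal e) at_bot"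
    by (rule Limsup_lessD)
  then obtain N where N: "\<And>t. t \<le> N \<Longrightarrow> f t * \<bar>t\<bar> powr (2 * s) < e"
    unfolding eventually_at_bot_linorder less_ereal.simps(1) by blast
  show ?thesis
  proof (rule that[of "min N (-1)"])
    show "f t * \<bar>t\<bar> powr (2 * s) < e" if "t \<le> min N (-1)" for t
      by (rule N) (use that in simp)
  qed simp
qed

section \<open>Moving the plane\<close>

lemma plane_ordered_left_limit:
  fixes u :: "real ^ 'n \<Rightarrow> real"
  assumes cont: "continuous_on UNIV u" and less: "\<And>l. l < l0 \<Longrightarrow> plane_ordered k u l"
  shows "plane_ordered k u l0"
  unfolding plane_ordered_def
proof (intro allI impI)
  fix y :: "real ^ 'n" assume y: "y $ k < l0"
  have "continuous_on UNIV (\<lambda>l. u (reflect k l y))"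
    unfolding reflect_def by (intro continuous_on_compose2[OF cont] continuous_intros) auto
  then have "((\<lambda>l. u (reflect k l y)) \<longlongrightarrow> u (reflect k l0 y)) (at_left l0)"
    by (simp add: continuous_on_eq_continuous_at isCont_def filterlim_at_split)
  moreover have "\<forall>\<^sub>F l in at_left l0. u y \<le> u (reflect k l y)"
    using eventually_at_left_real[OF y]
    by (rule eventually_mono) (use less in \<open>auto simp: plane_ordered_def\<close>)
  ultimately show "u y \<le> u (reflect k l0 y)" by (rule tendsto_lowerbound) simp
qed

lemma continuation_along_line:
  fixes P :: "real \<Rightarrow> bool"
  assumes start: "\<And>l. l \<le> a \<Longrightarrow> P l"
    and closed: "\<And>l. (\<And>l'. l' < l \<Longrightarrow> P l') \<Longrightarrow> P l"
    and "open": "\<And>l. P l \<Longrightarrow> \<exists>\<tau>>0. \<forall>l'. l < l' \<and> l' < l + \<tau> \<longrightarrow> P l'"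
  shows "P l"
proof (rule ccontr)
  assume l: "\<not> P l"
  define A where "A = {q. \<forall>p\<le>q. P p}"
  have ne: "a \<in> A" using start by (simp add: A_def)
  have bdd: "bdd_above A" using l by (intro bdd_aboveI[of _ l] leI notI) (auto simp: A_def dest: less_imp_le)
  have below: "P p" if "p < Sup A" for p
    using less_cSup_iff[of A p] ne bdd that by (force simp: A_def)
  have P0: "P (Sup A)" using below by (rule closed)
  then obtain \<tau> where \<tau>: "0 < \<tau>" "\<And>p. Sup A < p \<Longrightarrow> p < Sup A + \<tau> \<Longrightarrow> P p"
    using "open" by blast
  have "P p" if "p \<le> Sup A + \<tau> / 2" for p
    using that below[of p] P0 \<tau>(1) \<tau>(2)[of p] by (cases "p < Sup A"; cases "p = Sup A") auto
  then have "Sup A + \<tau> / 2 \<in> A" unfolding A_def by blast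
  then have "Sup A + \<tau> / 2 \<le> Sup A" using bdd by (rule cSup_upper)
  then show False using \<tau> by simp
qed

context
  fixes k :: "'n::finite" and s :: real and f g :: "real \<Rightarrow> real" and u :: "real ^ 'n \<Rightarrow> real"
  assumes s: "0 < s" "s < 1"
    and F1: "F1 s f" and F2: "F2 g"
    and sol: "classical_solution k s f g u"
    and pos: "\<forall>x. u x > 0" and bdd: "bounded (range u)"
    and uc: "uniformly_continuous_on UNIV u"
begin

lemma f_strict_mono: "p < q \<Longrightarrow> f p < f q"
proof -
  assume "p < q"
  moreover have "strict_mono f" using F1 by (simp only: F1_def)
  ultimately show "f p < f q" by (simp only: strict_monoD)
qed

lemma g_pos: "0 < t \<Longrightarrow> 0 < g t"
  using F2 by (simp only: F2_def)

lemma g_mono: "0 < a \<Longrightarrow> a \<le> b \<Longrightarrow> g a \<le> g b"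
proof -
  assume "0 < a" "a \<le> b"
  moreover have "mono_on {0<..} g" using F2 by (simp only: F2_def)
  ultimately show "g a \<le> g b" by (auto intro: mono_onD[of "{0<..}" g])
qed

text \<open>
  To the left of a negative level, \<open>d = l - x $ k\<close> is at most \<open>\<bar>x $ k\<bar>\<close>, so the inequality
  \<open>c \<le> f (x $ k) * K * d powr (2 * s)\<close> contradicts the decay of \<open>f\<close>.
\<close>

lemma plane_ordered_far_left: "\<exists>N. \<forall>l\<le>N. plane_ordered k u l"
proof -
  obtain M where M: "\<And>y. u y \<le> M" using bdd by (auto simp: bounded_iff abs_le_iff)
  obtain c where c: "0 < c" and viol:
    "\<And>l. \<not> plane_ordered k u l \<Longrightarrow> \<exists>x m. 0 < m \<and> x $ k < l \<and> u x - u (reflect k l x) \<le> m \<and>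
       u (reflect k l x) < u x \<and> c * m * (l - x $ k) powr (- 2 * s)
          \<le> f (x $ k) * g (u x) - f (2 * l - x $ k) * g (u (reflect k l x))"
    by (rule violation_inequality[OF s sol bdd uc]) blast
  obtain K where K: "0 < K" "\<And>a b. 0 < a \<Longrightarrow> a \<le> b \<Longrightarrow> b \<le> M \<Longrightarrow> g b - g a \<le> K * (b - a)"
    by (rule upper_lipschitz_down_to_zero[OF F2, of M]) blast
  obtain N where N: "N < 0" "\<And>t. t \<le> N \<Longrightarrow> f t * \<bar>t\<bar> powr (2 * s) < c / K"
    using F1_decay[OF F1, of "c / K"] c K by auto
  have "plane_ordered k u l" if l: "l \<le> N" for l
  proof (rule ccontr)
    assume "\<not> plane_ordered k u l"
    from viol[OF this] obtain x m where m: "0 < m" and x: "x $ k < l" "u x - u (reflect k l x) \<le> m" "u (reflect k l x) < u x"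
      and ineq: "c * m * (l - x $ k) powr (- 2 * s) \<le> f (x $ k) * g (u x) - f (2 * l - x $ k) * g (u (reflect k l x))"
      by blast
    have "0 < f (x $ k)" "c \<le> f (x $ k) * K * (l - x $ k) powr (2 * s)"
      by (rule reaction_forces_slope[OF ineq c m]; use x pos M in \<open>auto intro!: f_strict_mono g_pos g_mono K(2)\<close>)+
    moreover have "(l - x $ k) powr (2 * s) \<le> \<bar>x $ k\<bar> powr (2 * s)"
      using x l N s by (intro powr_mono2) auto
    ultimately have "c \<le> f (x $ k) * K * \<bar>x $ k\<bar> powr (2 * s)"
      using K by (smt (verit) mult_left_mono mult_pos_pos)
    moreover have "f (x $ k) * \<bar>x $ k\<bar> powr (2 * s) < c / K" using N(2)[of "x $ k"] x l by simp
    then have "f (x $ k) * \<bar>x $ k\<bar> powr (2 * s) * K < c" using K by (simp add: pos_less_divide_eq)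
    ultimately show False by (simp add: mult_ac)
  qed
  then show ?thesis by blast
qed

text \<open>
  Suppose that the order fails at a level \<open>l\<close> slightly above \<open>l0\<close>. The forced inequality
  \<open>c \<le> f t * \<kappa> * d powr (2 * s)\<close> confines the near minimum in three ways, uniformly in \<open>l\<close>:
  \<open>d \<ge> d0\<close> since \<open>f t \<le> Fb\<close>; \<open>d \<le> D\<close> since \<open>f\<close> decays at \<open>-\<infinity>\<close>; and \<open>u x \<ge> \<eta>\<close>
  since below \<open>\<eta>\<close> the slope \<open>\<kappa>\<close> may be replaced by the small number \<open>e\<close>. All constants are fixed
  before \<open>l\<close>. By the order at \<open>l0\<close> and uniform continuity, \<open>u x - u (R x) < \<mu>\<close>, so that the difference of
  the values of \<open>g\<close> cannot pay for the jump of \<open>f\<close> across the distance \<open>2 * d\<close>, which costs at least \<open>c1\<close>.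
\<close>

lemma plane_ordered_open_right:
  assumes l0: "plane_ordered k u l0"
  shows "\<exists>\<tau>>0. \<forall>l. l0 < l \<and> l < l0 + \<tau> \<longrightarrow> plane_ordered k u l"
proof -
  obtain M where M: "\<And>y. u y \<le> M" using bdd by (auto simp: bounded_iff abs_le_iff)
  obtain c where c: "0 < c" and viol:
    "\<And>l. \<not> plane_ordered k u l \<Longrightarrow> \<exists>x m. 0 < m \<and> x $ k < l \<and> u x - u (reflect k l x) \<le> m \<and>
       u (reflect k l x) < u x \<and> c * m * (l - x $ k) powr (- 2 * s)
          \<le> f (x $ k) * g (u x) - f (2 * l - x $ k) * g (u (reflect k l x))"
    by (rule violation_inequality[OF s sol bdd uc]) blast
  obtain K where K: "0 < K" "\<And>a b. 0 < a \<Longrightarrow> a \<le> b \<Longrightarrow> b \<le> M \<Longrightarrow> g b - g a \<le> K * (b - a)"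
    by (rule upper_lipschitz_down_to_zero[OF F2, of M]) blast
  define Fb where "Fb = max (f (l0 + 1)) 1"
  have Fb: "0 < Fb" "\<And>t. t < l0 + 1 \<Longrightarrow> f t \<le> Fb"
    using f_strict_mono[of _ "l0 + 1"] by (auto simp: Fb_def less_imp_le le_max_iff_disj)
  define d0 where "d0 = (c / (Fb * K)) powr (1 / (2 * s))"
  have d0: "0 < d0" "d0 powr (2 * s) = c / (Fb * K)" using c Fb K s by (auto simp: d0_def powr_powr)
  obtain N where N: "N < 0" "\<And>t. t \<le> N \<Longrightarrow> f t * \<bar>t\<bar> powr (2 * s) < c / (4 * K)"
    using F1_decay[OF F1, of "c / (4 * K)"] c K by auto
  \<comment> \<open>Left of \<open>- R\<close> one has \<open>d \<le> 2 * \<bar>t\<bar>\<close>, so \<open>d powr (2 * s) \<le> 4 * \<bar>t\<bar> powr (2 * s)\<close>; this explains the factor 4 in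
    the choice of \<open>N\<close>.\<close>
  define R where "R = max \<bar>N\<bar> (\<bar>l0\<bar> + 1)"
  define D where "D = l0 + 1 + R"
  have D: "0 < D" by (auto simp: D_def R_def)
  \<comment> \<open>The slope for which \<open>Fb * e * D powr (2 * s) = c / 2 < c\<close>.\<close>
  define e where "e = c / (2 * Fb * D powr (2 * s))"
  have e: "0 < e" using c Fb D by (simp add: e_def)
  obtain \<eta> where \<eta>: "0 < \<eta>" "\<And>a b. 0 < a \<Longrightarrow> a \<le> b \<Longrightarrow> b < \<eta> \<Longrightarrow> g b - g a \<le> e * (b - a)"
    by (rule small_slope_near_zero[OF F2 e]) blast
  define c1 where "c1 = (f (l0 + d0) - f (l0 - d0 / 2)) * g (\<eta> / 2)"
  have c1: "0 < c1" using f_strict_mono[of "l0 - d0 / 2" "l0 + d0"] g_pos[of "\<eta> / 2"] d0 \<eta> by (simp add: c1_def)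
  define \<mu> where "\<mu> = min (\<eta> / 2) (c1 / (Fb * K))"
  have \<mu>: "0 < \<mu>" "\<mu> \<le> \<eta> / 2" "Fb * K * \<mu> \<le> c1"
  proof -
    show "0 < \<mu>" using \<eta>(1) c1 Fb(1) K(1) by (simp add: \<mu>_def)
    show "\<mu> \<le> \<eta> / 2" by (simp only: \<mu>_def min.cobounded1)
    have "\<mu> \<le> c1 / (Fb * K)" by (simp add: \<mu>_def)
    then show "Fb * K * \<mu> \<le> c1" using Fb K by (simp add: pos_le_divide_eq mult_ac)
  qed
  obtain \<delta> where \<delta>: "0 < \<delta>" "\<And>y z. dist y z < \<delta> \<Longrightarrow> dist (u y) (u z) < \<mu>"
    using uc \<mu>(1) unfolding uniformly_continuous_on_def by (metis UNIV_I)
  define \<tau> where "\<tau> = min 1 (min (d0 / 2) (\<delta> / 2))"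
  have \<tau>: "0 < \<tau>" "\<tau> \<le> 1" "\<tau> \<le> d0 / 2" "\<tau> \<le> \<delta> / 2" using d0 \<delta> by (auto simp: \<tau>_def)
  have "plane_ordered k u l" if l: "l0 < l" "l < l0 + \<tau>" for l
  proof (rule ccontr)
    assume "\<not> plane_ordered k u l"
    from viol[OF this] obtain x m where m: "0 < m" and x: "x $ k < l" "u x - u (reflect k l x) \<le> m" "u (reflect k l x) < u x"
      and ineq: "c * m * (l - x $ k) powr (- 2 * s) \<le> f (x $ k) * g (u x) - f (2 * l - x $ k) * g (u (reflect k l x))"
      by blast
    define t where "t = x $ k"
    define d where "d = l - t"
    define a where "a = u x"
    define b where "b = u (reflect k l x)"
    have d: "0 < d" using x by (simp add: d_def t_def)
    have ab: "0 < b" "b < a" "a - b \<le> m" "a \<le> M" using x pos M by (auto simp: a_def b_def)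
    have ineq: "c * m * d powr (- 2 * s) \<le> f t * g a - f (2 * l - t) * g b"
      using ineq by (simp add: d_def t_def a_def b_def)
    have ft: "f t < f (2 * l - t)" "f t \<le> Fb" using x l \<tau> by (auto intro!: f_strict_mono Fb(2) simp: t_def)
    have gab: "0 < g b" "g b \<le> g a" using ab by (auto intro: g_pos g_mono)
    have slope: "g a - g b \<le> K * (a - b)" using ab by (intro K(2)) auto
    note forced = reaction_forces_slope[OF ineq c m d ft(1) gab _ ab(2,3)]
    have fpos: "0 < f t" and cK: "c \<le> f t * K * d powr (2 * s)" by (rule forced[OF slope])+
    have "d0 \<le> d"
    proof (rule ccontr)
      assume "\<not> d0 \<le> d"
      then have "d powr (2 * s) < d0 powr (2 * s)" using d s by (intro powr_less_mono2) auto
      then have "Fb * K * d powr (2 * s) < Fb * K * (c / (Fb * K))"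
        using Fb K d0 by (intro mult_strict_left_mono) auto
      moreover have "f t * K * d powr (2 * s) \<le> Fb * K * d powr (2 * s)"
        using ft K by (intro mult_right_mono) auto
      ultimately show False using cK Fb K by simp
    qed
    have "- R \<le> t"
    proof (rule ccontr)
      assume "\<not> - R \<le> t"
      then have t: "t \<le> N" "\<bar>l0\<bar> + 1 \<le> \<bar>t\<bar>" using N(1) by (auto simp: R_def)
      then have "d \<le> 2 * \<bar>t\<bar>" using l \<tau> by (auto simp: d_def)
      then have "d powr (2 * s) \<le> (2 * \<bar>t\<bar>) powr (2 * s)" using d s by (intro powr_mono2) auto
      also have "\<dots> = 2 powr (2 * s) * \<bar>t\<bar> powr (2 * s)" by (simp add: powr_mult)
      also have "\<dots> \<le> 2 powr 2 * \<bar>t\<bar> powr (2 * s)" using s by (intro mult_right_mono powr_mono) auto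
      finally have "d powr (2 * s) \<le> 4 * \<bar>t\<bar> powr (2 * s)" by simp
      then have "f t * K * d powr (2 * s) \<le> f t * K * (4 * \<bar>t\<bar> powr (2 * s))"
        using fpos K by (intro mult_left_mono) auto
      moreover have "f t * \<bar>t\<bar> powr (2 * s) * (4 * K) < c"
        using N(2)[OF t(1)] K by (simp add: pos_less_divide_eq)
      ultimately show False using cK by (simp add: mult_ac)
    qed
    then have dD: "d \<le> D" using l \<tau> by (simp add: d_def D_def)
    have "\<eta> \<le> a"
    proof (rule ccontr)
      assume "\<not> \<eta> \<le> a"
      then have "g a - g b \<le> e * (a - b)" using ab by (intro \<eta>(2)) auto
      then have "c \<le> f t * e * d powr (2 * s)" by (rule forced(2))
      also have "\<dots> \<le> Fb * e * D powr (2 * s)"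
        using ft e d dD s Fb by (intro mult_mono mult_right_mono powr_mono2) auto
      also have "\<dots> = c / 2" using Fb D by (simp add: e_def)
      finally show False using c by simp
    qed
    have amu: "a - b < \<mu>"
    proof -
      have "x $ k < l0" using \<open>d0 \<le> d\<close> l \<tau> d0 by (simp add: d_def t_def)
      then have "a \<le> u (reflect k l0 x)" using l0 by (simp add: plane_ordered_def a_def)
      moreover have "reflect k l0 x - reflect k l x = (2 * (l0 - l)) *\<^sub>R axis k 1"
        by (simp add: reflect_def algebra_simps)
      then have "dist (reflect k l0 x) (reflect k l x) < \<delta>"
        using l \<tau> by (simp add: dist_norm norm_axis_1)
      then have "dist (u (reflect k l0 x)) b < \<mu>" unfolding b_def by (rule \<delta>(2))
      ultimately show ?thesis unfolding dist_real_def by linarith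
    qed
    have "\<eta> / 2 \<le> b" using amu \<mu>(2) \<open>\<eta> \<le> a\<close> by linarith
    then have gb: "g (\<eta> / 2) \<le> g b" using \<eta> by (intro g_mono) auto
    have "f (l0 + d0) \<le> f (2 * l - t)" "f t \<le> f (l0 - d0 / 2)"
    proof -
      have "l0 + d0 < 2 * l - t" "t < l0 - d0 / 2" using \<open>d0 \<le> d\<close> l \<tau> by (auto simp: d_def)
      then show "f (l0 + d0) \<le> f (2 * l - t)" "f t \<le> f (l0 - d0 / 2)" by (auto intro: less_imp_le f_strict_mono)
    qed
    then have "c1 \<le> (f (2 * l - t) - f t) * g b"
      unfolding c1_def using gb g_pos[of "\<eta> / 2"] \<eta> ft by (intro mult_mono) auto
    also have "\<dots> < f t * (g a - g b)"
    proof -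
      have "0 < c * m * d powr (- 2 * s)" using c m d by simp
      then show ?thesis using ineq by (simp add: algebra_simps)
    qed
    also have "\<dots> \<le> Fb * (K * (a - b))" using ft fpos slope gab Fb by (intro mult_mono) auto
    also have "\<dots> \<le> Fb * (K * \<mu>)" using amu Fb K by (intro mult_left_mono) auto
    finally show False using \<mu>(3) by (simp add: mult_ac)
  qed
  then show ?thesis using \<tau>(1) by blast
qed

lemma plane_ordered_everywhere: "plane_ordered k u l"
proof -
  obtain N where N: "\<And>l. l \<le> N \<Longrightarrow> plane_ordered k u l" using plane_ordered_far_left by blast
  have cont: "continuous_on UNIV u" by (rule uniformly_continuous_imp_continuous[OF uc])
  show ?thesis
    by (rule continuation_along_line[where P = "plane_ordered k u", OF N])
      (auto intro: plane_ordered_left_limit[OF cont] plane_ordered_open_right)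
qed

end

theorem theorem1p1:
  fixes k :: "'n::finite" and s :: real and f g :: "real \<Rightarrow> real" and u :: "real ^ 'n \<Rightarrow> real"
  assumes "0 < s" and "s < 1"
    and "F1 s f" and "F2 g"
    and "classical_solution k s f g u"
    and "\<forall>x. u x > 0" and "bounded (range u)"
    and "uniformly_continuous_on UNIV u"
  shows "\<forall>x t. t > 0 \<longrightarrow> u x < u (x + t *\<^sub>R axis k 1)"
proof (intro allI impI)
  fix x :: "real ^ 'n" and t :: real assume t: "0 < t"
  define l where "l = x $ k + t / 2"
  have R: "reflect k l x = x + t *\<^sub>R axis k 1" by (simp add: reflect_def l_def)
  have xl: "x $ k < l" using t by (simp add: l_def)
  have ordered: "plane_ordered k u l" by (rule plane_ordered_everywhere[OF assms])
  have "u (reflect k l x) \<noteq> u x"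
  proof
    assume touch: "u (reflect k l x) = u x"
    have "f (2 * l - x $ k) * g (u x) \<le> f (x $ k) * g (u x)"
      by (rule touching_point_inequality[OF assms(1,2,5,7) ordered xl touch])
    moreover have "0 < g (u x)" using assms(4,6) by (simp only: F2_def)
    moreover have "f (x $ k) < f (2 * l - x $ k)"
      using assms(3) xl by (auto simp only: F1_def intro!: strict_monoD[of f])
    ultimately show False by simp
  qed
  moreover have "u x \<le> u (reflect k l x)" using ordered xl by (simp add: plane_ordered_def)
  ultimately show "u x < u (x + t *\<^sub>R axis k 1)" unfolding R by simp
qed

end
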